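(* Let $\mu,\nu,\sigma\in\mathbb{C}$ with $\sigma\neq0$, and suppose that $f(z)$ is a solution of $$f''+(e^{2z}-\nu^2)f=\sigma e^{(\mu+1)z}.$$ Then $\lambda(f)<+\infty$ if and only if the solution $f(z)$ is subnormal.
   Context: All solutions of this equation are entire. For an entire function $f\not\equiv0$, $\lambda(f)=\limsup_{r\to+\infty}\frac{\log n(r,1/f)}{\log r}$ is the exponent of convergence of zeros, where $n(r,1/f)$ is the number of zeros of $f$ in $|z|\le r$ counted with multiplicity ($\lambda(f)=0$ if $f$ has finitely many zeros). An entire function $f$ is called subnormal if either $$\limsup_{r\to+\infty}\frac{\log\log M(r,f)}{r}=0\quad\text{or}\quad\limsup_{r\to+\infty}\frac{\log T(r,f)}{r}=0$$ holds, where $M(r,f)=\max_{|z|\le r}|f(z)|$ and $T(r,f)$ is the Nevanlinna characteristic of $f$. *)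

theory Defs
  imports "HOL-Complex_Analysis.Complex_Analysis"
begin

(* The limsups below are taken in the extended reals, of expressions in the library's total
   real ln.  For an entire function the arguments of ln are nondecreasing in r, and they are
   eventually positive except in two cases.  If f has no zeros, then ln 0 = 0 makes the exponent
   of convergence 0, which is the usual convention.  If f is constant with modulus at most 1, then
   the quotients in the definition of subnormal are a fixed real number divided by r, so f is
   subnormal, as are all other constants. *)

text \<open>The number of zeros of \<open>f\<close> in \<open>|z| \<le> r\<close>, counted with multiplicity, usually written
  \<open>n(r, 1/f)\<close>.  It is meant for entire functions that do not vanish identically, which have only
  finitely many zeros in a disc.\<close>

definition zero_count :: "(complex \<Rightarrow> complex) \<Rightarrow> real \<Rightarrow> nat" where
  "zero_count f r = (\<Sum>z | cmod z \<le> r \<and> f z = 0. nat (zorder f z))"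

definition convergence_exponent :: "(complex \<Rightarrow> complex) \<Rightarrow> ereal" where
  "convergence_exponent f =
     Limsup at_top (\<lambda>r::real. ereal (ln (real (zero_count f r)) / ln r))"

definition max_modulus :: "(complex \<Rightarrow> complex) \<Rightarrow> real \<Rightarrow> real" where
  "max_modulus f r = (SUP z\<in>cball 0 r. cmod (f z))"

definition log_plus :: "real \<Rightarrow> real" where
  "log_plus x = ln (max 1 x)"

definition proximity :: "(complex \<Rightarrow> complex) \<Rightarrow> real \<Rightarrow> real" where
  "proximity f r =
     1 / (2 * pi) * integral {0..2 * pi} (\<lambda>\<theta>. log_plus (cmod (f (of_real r * cis \<theta>))))"

text \<open>\<^const>\<open>zorder\<close> is minus the multiplicity at a pole.\<close>

definition pole_count :: "(complex \<Rightarrow> complex) \<Rightarrow> real \<Rightarrow> nat" where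
  "pole_count f r = (\<Sum>z | cmod z \<le> r \<and> is_pole f z. nat (- zorder f z))"

definition integrated_pole_count :: "(complex \<Rightarrow> complex) \<Rightarrow> real \<Rightarrow> real" where
  "integrated_pole_count f r =
     integral {0..r} (\<lambda>t. (real (pole_count f t) - real (pole_count f 0)) / t)
       + real (pole_count f 0) * ln r"

definition nevanlinna_characteristic :: "(complex \<Rightarrow> complex) \<Rightarrow> real \<Rightarrow> real" where
  "nevanlinna_characteristic f r = proximity f r + integrated_pole_count f r"

definition subnormal :: "(complex \<Rightarrow> complex) \<Rightarrow> bool" where
  "subnormal f \<longleftrightarrow>
     f holomorphic_on UNIV \<and>
     (Limsup at_top (\<lambda>r::real. ereal (ln (ln (max_modulus f r)) / r)) = 0 \<or>
      Limsup at_top (\<lambda>r::real. ereal (ln (nevanlinna_characteristic f r) / r)) = 0)"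

end

theory Submission
  imports Defs
begin

text \<open>
  Suppose \<open>\<lambda>(f) < \<infinity>\<close>. By the equation, \<open>|f|\<close> cannot be smaller than \<open>e\<^sup>-\<^sup>C\<^sup>(\<^sup>|\<^sup>z\<^sup>|\<^sup>+\<^sup>1\<^sup>)\<close> throughout a disc of radius
  \<open>\<delta>\<close>, because the right-hand side is not. As \<open>f\<close> has only polynomially many zeros, \<open>log |f|\<close> is, up to
  polynomial terms, harmonic in a disc of large radius \<open>R\<close> around a point of maximum modulus, and
  Harnack's inequality gives
  \<open>log M(r - 1) \<ge> (1 - 6/R) log M(r) - 3 \<delta> log M(r + R + 1) - O(r\<^sup>p)\<close>. Since \<open>log M(r) = O(e\<^sup>3\<^sup>r)\<close> a priori,
  \<open>\<delta>\<close> can be chosen so small that the middle term is negligible, and \<open>log M\<close> grows more slowly than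
  every exponential.

  Suppose \<open>f\<close> is subnormal. Then \<open>log |f(z)| = O(e\<^sup>|\<^sup>z\<^sup>|\<^sup>/\<^sup>2)\<close>; if the hypothesis concerns \<open>T(r, f)\<close>, this uses the
  Poisson bound of \<open>log M\<close> by \<open>T\<close>. In the left half-plane \<open>f\<close> has at most exponential growth by
  Gronwall's inequality, and on the lines \<open>Im z = k \<pi>\<close> by an energy estimate. The Phragmen-Lindelof
  principle in the half-strips between these lines shows that \<open>f\<close> is of exponential type, so the number
  of zeros in \<open>|z| \<le> r\<close> is \<open>O(r)\<close>.
\<close>

text \<open>The obstacle in the first half is that Harnack's inequality compares
  \<open>log M (k - 1)\<close> with \<open>log M k\<close> only up to an error measured at the
  larger radius \<open>k + R + 1\<close>, where nothing but the a priori bound is known. The remedy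
  is to consider indices at which \<open>log M k\<close>, corrected by a polynomial and weighted by
  \<open>exp (- 4 * k)\<close>, is maximal among all later ones: there the value at distance
  \<open>m\<close> further out exceeds the present one by a factor of at most
  \<open>exp (4 * m)\<close>. This dictates the order of the choices: the target rate determines the
  loss \<open>h\<close> allowed per unit step, \<open>h\<close> determines \<open>R\<close>,
  \<open>R\<close> determines \<open>m\<close>, and only then is \<open>\<delta>\<close> taken
  small. The rate 4 only has to exceed the a priori rate 3. In the second half, Gronwall's
  inequality alone fails in the right half-plane, where the coefficient is exponentially large. The
  lines \<open>Im z = k * pi\<close> are those on which exp (2 z) is a positive real number. They
  are pi apart, so the critical growth for Phragmen-Lindelof is exp (c exp |z|), and the exponent
  |z|/2 leaves room for a comparison function built from exp (3 z / 4).\<close>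

section \<open>Harnack's inequality\<close>

text \<open>The Cayley map w -> (w - g z0) / (w + cnj (g z0)) takes the right half-plane to the unit
  disc and \<open>g z0\<close> to 0. After rescaling the ball to the unit disc, the Schwarz lemma
  bounds its composition with \<open>g\<close>, and squaring that bound yields both
  inequalities.\<close>

lemma harnack_pos:
  assumes hol: "g holomorphic_on ball z0 R"
    and pos: "\<And>w. w \<in> ball z0 R \<Longrightarrow> Re (g w) > 0"
    and z: "z \<in> ball z0 R"
  shows "(R - dist z0 z) * Re (g z0) \<le> (R + dist z0 z) * Re (g z)"
    and "(R - dist z0 z) * Re (g z) \<le> (R + dist z0 z) * Re (g z0)"
proof -
  have R: "R > 0" using z zero_le_dist[of z0 z] by (simp del: zero_le_dist)
  define a where "a = Re (g z0)"
  have a: "a > 0" unfolding a_def using pos R by simp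
  define \<phi> where "\<phi> \<zeta> = (g (z0 + of_real R * \<zeta>) - g z0) / (g (z0 + of_real R * \<zeta>) + cnj (g z0))" for \<zeta>
  have inball: "z0 + of_real R * \<zeta> \<in> ball z0 R" if "\<zeta> \<in> ball 0 1" for \<zeta>
    using that R by (simp add: dist_norm norm_mult)
  have gpos: "Re (g (z0 + of_real R * \<zeta>)) > 0" if "\<zeta> \<in> ball 0 1" for \<zeta>
    using pos inball that by blast
  have nz: "g (z0 + of_real R * \<zeta>) + cnj (g z0) \<noteq> 0" if "\<zeta> \<in> ball 0 1" for \<zeta>
  proof
    assume "g (z0 + of_real R * \<zeta>) + cnj (g z0) = 0"
    then have "Re (g (z0 + of_real R * \<zeta>) + cnj (g z0)) = 0" by (simp only: zero_complex.simps)
    then show False using gpos[OF that] a by (simp add: a_def)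
  qed
  have "(g \<circ> (\<lambda>\<zeta>. z0 + of_real R * \<zeta>)) holomorphic_on ball 0 1"
    by (rule holomorphic_on_compose_gen[OF _ hol]) (use inball in \<open>auto intro!: holomorphic_intros\<close>)
  then have holc: "(\<lambda>\<zeta>. g (z0 + of_real R * \<zeta>)) holomorphic_on ball 0 1"
    by (simp add: o_def)
  have hol\<phi>: "\<phi> holomorphic_on ball 0 1"
    unfolding \<phi>_def by (intro holomorphic_intros holc) (use nz in auto)
  have eq: "(cmod (w + cnj (g z0)))\<^sup>2 - (cmod (w - g z0))\<^sup>2 = 4 * Re w * a" for w
    unfolding cmod_power2 by (simp add: a_def power2_eq_square algebra_simps)
  have no: "norm (\<phi> \<zeta>) < 1" if "norm \<zeta> < 1" for \<zeta>
  proof -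
    let ?w = "g (z0 + of_real R * \<zeta>)"
    have "\<zeta> \<in> ball 0 1" using that by simp
    then have "0 < 4 * Re ?w * a" using gpos a by simp
    then have "(cmod (?w - g z0))\<^sup>2 < (cmod (?w + cnj (g z0)))\<^sup>2" using eq[of ?w] by linarith
    then have "cmod (?w - g z0) < cmod (?w + cnj (g z0))"
      by (rule power2_less_imp_less) simp
    then show ?thesis unfolding \<phi>_def by (simp add: norm_divide divide_less_eq)
  qed
  have \<phi>0: "\<phi> 0 = 0" by (simp add: \<phi>_def)
  define \<zeta> where "\<zeta> = (z - z0) / of_real R"
  have n\<zeta>: "norm \<zeta> = dist z0 z / R" using R by (simp add: \<zeta>_def norm_divide dist_norm norm_minus_commute)
  have \<zeta>1: "norm \<zeta> < 1" using z R by (simp add: n\<zeta>)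
  have z_eq: "z0 + of_real R * \<zeta> = z" using R by (simp add: \<zeta>_def)
  define t where "t = norm \<zeta>"
  have t: "0 \<le> t" "t < 1" using \<zeta>1 by (auto simp: t_def)
  have "norm (\<phi> \<zeta>) \<le> t"
    unfolding t_def by (rule Schwarz_Lemma(1)[OF hol\<phi> \<phi>0 no \<zeta>1])
  then have "cmod (g z - g z0) \<le> t * cmod (g z + cnj (g z0))"
    using nz[of \<zeta>] \<zeta>1 by (simp add: \<phi>_def z_eq norm_divide divide_le_eq)
  then have "(cmod (g z - g z0))\<^sup>2 \<le> (t * cmod (g z + cnj (g z0)))\<^sup>2"
    by (rule power_mono) simp
  then have le: "(Re (g z) - a)\<^sup>2 + (Im (g z) - Im (g z0))\<^sup>2
      \<le> t\<^sup>2 * ((Re (g z) + a)\<^sup>2 + (Im (g z) - Im (g z0))\<^sup>2)"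
    by (simp add: power_mult_distrib cmod_power2 a_def)
  have t2: "t\<^sup>2 \<le> 1" using t by (simp add: power_le_one)
  have "t\<^sup>2 * (Im (g z) - Im (g z0))\<^sup>2 \<le> 1 * (Im (g z) - Im (g z0))\<^sup>2"
    by (rule mult_right_mono[OF t2]) simp
  then have "(Re (g z) - a)\<^sup>2 \<le> t\<^sup>2 * (Re (g z) + a)\<^sup>2"
    using le by (simp add: algebra_simps)
  then have "(Re (g z) - a)\<^sup>2 \<le> (t * (Re (g z) + a))\<^sup>2" by (simp add: power_mult_distrib)
  moreover have gz: "Re (g z) > 0" using pos z by blast
  ultimately have ab: "\<bar>Re (g z) - a\<bar> \<le> t * (Re (g z) + a)"
    using a t by (metis abs_le_square_iff abs_of_nonneg add_nonneg_nonneg less_imp_le mult_nonneg_nonneg)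
  have tR: "t * R = dist z0 z" using R by (simp add: t_def n\<zeta>)
  have "R * \<bar>Re (g z) - a\<bar> \<le> R * (t * (Re (g z) + a))" using ab R by (intro mult_left_mono) auto
  then have ab': "R * \<bar>Re (g z) - a\<bar> \<le> dist z0 z * (Re (g z) + a)"
    using tR by (simp add: mult.assoc[symmetric] mult.commute)
  have "R * (a - Re (g z)) \<le> R * \<bar>Re (g z) - a\<bar>" "R * (Re (g z) - a) \<le> R * \<bar>Re (g z) - a\<bar>"
    using R by (auto intro!: mult_left_mono)
  then show "(R - dist z0 z) * Re (g z0) \<le> (R + dist z0 z) * Re (g z)"
    and "(R - dist z0 z) * Re (g z) \<le> (R + dist z0 z) * Re (g z0)"
    using ab' unfolding a_def[symmetric] by (auto simp: algebra_simps)
qed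

text \<open>Real parts that may vanish are handled by adding a constant \<open>e > 0\<close> to
  \<open>g\<close>. This changes the two sides by amounts that differ by
  \<open>2 * dist z0 z * e\<close>, which tends to 0 with \<open>e\<close>.\<close>

lemma harnack:
  assumes hol: "g holomorphic_on ball z0 R"
    and nonneg: "\<And>w. w \<in> ball z0 R \<Longrightarrow> Re (g w) \<ge> 0"
    and z: "z \<in> ball z0 R"
  shows "(R - dist z0 z) * Re (g z0) \<le> (R + dist z0 z) * Re (g z)"
    and "(R - dist z0 z) * Re (g z) \<le> (R + dist z0 z) * Re (g z0)"
proof -
  have R: "R > dist z0 z" using z by simp
  have *: "(R - dist z0 z) * (Re (g z0) + e) \<le> (R + dist z0 z) * (Re (g z) + e)"
     "(R - dist z0 z) * (Re (g z) + e) \<le> (R + dist z0 z) * (Re (g z0) + e)" if "e > 0" for e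
  proof -
    have "(\<lambda>w. g w + of_real e) holomorphic_on ball z0 R" by (intro holomorphic_intros hol)
    from harnack_pos[OF this _ z] show "(R - dist z0 z) * (Re (g z0) + e) \<le> (R + dist z0 z) * (Re (g z) + e)"
     "(R - dist z0 z) * (Re (g z) + e) \<le> (R + dist z0 z) * (Re (g z0) + e)"
      using nonneg that by (auto simp: add_nonneg_pos)
  qed
  have key: "x \<le> y" if "\<And>e. e > 0 \<Longrightarrow> x \<le> y + 2 * dist z0 z * e" for x y
  proof (rule field_le_epsilon)
    fix e :: real assume e: "e > 0"
    define d where "d = e / (2 * dist z0 z + 1)"
    have den: "2 * dist z0 z + 1 > 0" by (simp add: add_nonneg_pos)
    have d: "d > 0" using e den by (simp add: d_def)
    have "2 * dist z0 z * d \<le> (2 * dist z0 z + 1) * d" using d by (simp add: algebra_simps)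
    also have "\<dots> = e" using den by (simp add: d_def)
    finally show "x \<le> y + e" using that[OF d] by linarith
  qed
  show "(R - dist z0 z) * Re (g z0) \<le> (R + dist z0 z) * Re (g z)"
    by (rule key) (use *(1) in \<open>auto simp: algebra_simps\<close>)
  show "(R - dist z0 z) * Re (g z) \<le> (R + dist z0 z) * Re (g z0)"
    by (rule key) (use *(2) in \<open>auto simp: algebra_simps\<close>)
qed

section \<open>Growth lemmas\<close>

text \<open>If the inequality \<open>(1 - h) A\<^sub>n \<le> A\<^sub>n\<^sub>-\<^sub>1\<close> failed, the maximum of \<open>A\<^sub>k e\<^sup>-\<^sup>c\<^sup>k\<close> over \<open>k \<ge> n\<close> would be
  attained at an index where \<open>step\<close> applies, and this index would have to be \<open>n\<close> itself.\<close>

lemma slow_growth_of_peak_growth: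
  fixes A :: "nat \<Rightarrow> real" and c h :: real
  assumes pos: "\<And>k. A k > 0"
    and lim: "(\<lambda>k. A k * exp (- c * real k)) \<longlonglongrightarrow> 0"
    and h: "(1 - h) * exp c > 1"
    and step: "\<And>k. k \<ge> N \<Longrightarrow> A (k + m) \<le> exp (c * real m) * A k \<Longrightarrow> (1 - h) * A k \<le> A (k - 1)"
    and n: "n \<ge> N" "n \<ge> 1"
  shows "(1 - h) * A n \<le> A (n - 1)"
proof -
  define B where "B k = A k * exp (- c * real k)" for k
  have Bpos: "B k > 0" for k using pos by (simp add: B_def)
  from lim have "\<forall>\<^sub>F k in sequentially. B k < B n"
    unfolding B_def[symmetric] using Bpos by (rule order_tendstoD(2))
  then obtain M where M: "\<And>k. k \<ge> M \<Longrightarrow> B k < B n" by (auto simp: eventually_sequentially)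
  define K where "K = {n..max n M}"
  have "finite K" "K \<noteq> {}" by (auto simp: K_def)
  then have "Max (B ` K) \<in> B ` K" by (intro Max_in) auto
  then obtain k where k: "k \<in> K" "B k = Max (B ` K)" by force
  have kmaxK: "B j \<le> B k" if "j \<in> K" for j using that \<open>finite K\<close> by (simp add: k(2))
  have kmax: "B j \<le> B k" if "j \<ge> n" for j
  proof (cases "j \<in> K")
    case False
    then have "j \<ge> M" using that by (auto simp: K_def)
    then show ?thesis using M[of j] kmaxK[of n] by (auto simp: K_def)
  qed (use kmaxK in auto)
  have kn: "k \<ge> n" using k by (auto simp: K_def)
  have "B (k + m) \<le> B k" using kmax kn by simp
  then have "A (k + m) * exp (- c * real (k + m)) * exp (c * real (k + m))
     \<le> A k * exp (- c * real k) * exp (c * real (k + m))"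
    unfolding B_def by (intro mult_right_mono) auto
  then have "A (k + m) \<le> exp (c * real m) * A k"
    by (simp add: mult.assoc exp_add[symmetric] algebra_simps)
  then have st: "(1 - h) * A k \<le> A (k - 1)" using step kn n by simp
  \<comment> \<open>At a maximum \<open>k > n\<close> the hypothesis would make
    \<open>B (k - 1)\<close> at least \<open>(1 - h) * exp c > 1\<close> times
    \<open>B k\<close>.\<close>
  have "k = n"
  proof (rule ccontr)
    assume "k \<noteq> n"
    then have k1: "k - 1 \<ge> n" "k \<ge> 1" using kn n by auto
    have "(1 - h) * A k * exp (- c * real (k - 1)) \<le> B (k - 1)"
      unfolding B_def using st by (intro mult_right_mono) auto
    also have "\<dots> \<le> B k" using kmax k1 by blast
    also have "exp (- c * real (k - 1)) = exp c * exp (- c * real k)"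
      using k1(2) by (simp add: of_nat_diff exp_add[symmetric] algebra_simps)
    finally have "(1 - h) * exp c * B k \<le> 1 * B k" by (simp add: B_def algebra_simps)
    then show False using h Bpos[of k] using mult_less_cancel_right_pos[of "B k" 1 "(1 - h) * exp c"] by linarith
  qed
  then show ?thesis using st by simp
qed

section \<open>Gronwall estimates for second-order equations\<close>

lemma gronwall:
  fixes v :: "real \<Rightarrow> real"
  assumes "0 \<le> s"
    and der: "\<And>t. 0 \<le> t \<Longrightarrow> t \<le> s \<Longrightarrow> (v has_real_derivative v' t) (at t)"
    and le: "\<And>t. 0 \<le> t \<Longrightarrow> t \<le> s \<Longrightarrow> v' t \<le> c * v t"
  shows "v s \<le> v 0 * exp (c * s)"
proof -
  have "v s * exp (- c * s) \<le> v 0 * exp (- c * 0)"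
  proof (rule DERIV_nonpos_imp_nonincreasing[OF \<open>0 \<le> s\<close>])
    fix t assume t: "0 \<le> t" "t \<le> s"
    have "((\<lambda>t. v t * exp (- c * t)) has_real_derivative (v' t - c * v t) * exp (- c * t)) (at t)"
      by (auto intro!: derivative_eq_intros der[OF t] simp: algebra_simps)
    moreover have "(v' t - c * v t) * exp (- c * t) \<le> 0"
      using le[OF t] by (simp add: mult_nonpos_nonneg)
    ultimately show "\<exists>y. ((\<lambda>t. v t * exp (- c * t)) has_real_derivative y) (at t) \<and> y \<le> 0" by blast
  qed
  then have "v s * exp (- c * s) * exp (c * s) \<le> v 0 * exp (c * s)" by (intro mult_right_mono) auto
  then show ?thesis by (simp add: mult.assoc exp_add[symmetric])
qed

lemma has_real_derivative_norm_square:
  fixes \<phi> :: "real \<Rightarrow> complex"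
  assumes "(\<phi> has_vector_derivative \<phi>') (at t)"
  shows "((\<lambda>t. (cmod (\<phi> t))\<^sup>2) has_real_derivative 2 * (\<phi> t \<bullet> \<phi>')) (at t)"
proof -
  have "((\<lambda>t. \<phi> t \<bullet> \<phi> t) has_vector_derivative (\<phi> t \<bullet> \<phi>' + \<phi>' \<bullet> \<phi> t)) (at t)"
    by (rule bounded_bilinear.has_vector_derivative[OF bounded_bilinear_inner assms assms])
  then show ?thesis
    by (simp add: has_real_derivative_iff_has_vector_derivative power2_norm_eq_inner inner_commute)
qed

lemma entire_line_derivative:
  assumes "f holomorphic_on UNIV"
  shows "((\<lambda>t. f (a + of_real t * b)) has_vector_derivative (b * deriv f (a + of_real t * b))) (at t)"
proof -
  have d: "(f has_field_derivative deriv f (a + of_real t * b)) (at (a + of_real t * b))"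
    using assms by (simp add: holomorphic_derivI)
  have "((\<lambda>t. a + of_real t * b) has_vector_derivative b) (at t)"
    by (auto intro!: derivative_eq_intros)
  from field_vector_diff_chain_at[OF this d] show ?thesis by (simp add: o_def mult.commute)
qed

text \<open>Including the constant S^2 in the energy absorbs the inhomogeneous term through 2 S |f'|
  \<le> S^2 + |f'|^2, so that the differential inequality along the segment becomes
  homogeneous.\<close>

lemma gronwall_second_order:
  assumes hol: "f holomorphic_on UNIV" and K: "K \<ge> 0" and S: "S \<ge> 0"
    and le: "\<And>w. w \<in> closed_segment a z \<Longrightarrow> cmod (deriv (deriv f) w) \<le> K * cmod (f w) + S"
  shows "S\<^sup>2 + (cmod (f z))\<^sup>2 + (cmod (deriv f z))\<^sup>2
      \<le> (S\<^sup>2 + (cmod (f a))\<^sup>2 + (cmod (deriv f a))\<^sup>2) * exp ((K + 2) * cmod (z - a))"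
proof -
  have hol': "deriv f holomorphic_on UNIV" using hol by (simp add: holomorphic_deriv)
  define b where "b = z - a"
  define v where "v t = S\<^sup>2 + (cmod (f (a + of_real t * b)))\<^sup>2 + (cmod (deriv f (a + of_real t * b)))\<^sup>2" for t
  define v' where "v' t = 2 * (f (a + of_real t * b) \<bullet> (b * deriv f (a + of_real t * b)))
     + 2 * (deriv f (a + of_real t * b) \<bullet> (b * deriv (deriv f) (a + of_real t * b)))" for t
  have "v 1 \<le> v 0 * exp ((K + 2) * cmod b * 1)"
  proof (rule gronwall[where v' = v'])
    fix t :: real
    show "(v has_real_derivative v' t) (at t)"
      using DERIV_add[OF DERIV_add[OF DERIV_const[of "S\<^sup>2"]
            has_real_derivative_norm_square[OF entire_line_derivative[OF hol]]]
            has_real_derivative_norm_square[OF entire_line_derivative[OF hol']]]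
      unfolding v_def v'_def by simp
    assume t: "0 \<le> t" "t \<le> 1"
    let ?w = "a + of_real t * b"
    let ?x = "cmod (f ?w)" and ?y = "cmod (deriv f ?w)" and ?u = "cmod (deriv (deriv f) ?w)"
    have "?w \<in> closed_segment a z"
      using t unfolding closed_segment_def b_def by (auto intro!: exI[of _ t] simp: algebra_simps scaleR_conv_of_real)
    then have u: "?u \<le> K * ?x + S" by (rule le)
    have 1: "f ?w \<bullet> (b * deriv f ?w) \<le> cmod b * (?x * ?y)"
      using norm_cauchy_schwarz[of "f ?w" "b * deriv f ?w"] by (simp add: norm_mult algebra_simps)
    have 2: "deriv f ?w \<bullet> (b * deriv (deriv f) ?w) \<le> cmod b * (?y * ?u)"
      using norm_cauchy_schwarz[of "deriv f ?w" "b * deriv (deriv f) ?w"] by (simp add: norm_mult algebra_simps)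
    have xy: "2 * (?x * ?y) \<le> ?x\<^sup>2 + ?y\<^sup>2" using sum_squares_bound[of ?x ?y] by simp
    have "2 * (?y * ?u) \<le> 2 * (?y * (K * ?x + S))" using u by (intro mult_left_mono) auto
    also have "\<dots> = K * (2 * (?x * ?y)) + 2 * (S * ?y)" by (simp add: algebra_simps)
    also have "\<dots> \<le> K * (?x\<^sup>2 + ?y\<^sup>2) + (S\<^sup>2 + ?y\<^sup>2)"
      using mult_left_mono[OF xy K] sum_squares_bound[of S ?y] by simp
    finally have yu: "2 * (?y * ?u) \<le> K * (?x\<^sup>2 + ?y\<^sup>2) + (S\<^sup>2 + ?y\<^sup>2)" .
    have "v' t \<le> cmod b * (2 * (?x * ?y) + 2 * (?y * ?u))"
      using 1 2 unfolding v'_def by (simp add: algebra_simps)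
    also have "\<dots> \<le> cmod b * ((?x\<^sup>2 + ?y\<^sup>2) + (K * (?x\<^sup>2 + ?y\<^sup>2) + (S\<^sup>2 + ?y\<^sup>2)))"
      using xy yu by (intro mult_left_mono add_mono) auto
    also have "\<dots> \<le> cmod b * ((K + 2) * v t)"
    proof (rule mult_left_mono)
      have "0 \<le> (K + 1) * S\<^sup>2 + ?x\<^sup>2" using K by simp
      then show "(?x\<^sup>2 + ?y\<^sup>2) + (K * (?x\<^sup>2 + ?y\<^sup>2) + (S\<^sup>2 + ?y\<^sup>2)) \<le> (K + 2) * v t"
        unfolding v_def by (simp add: algebra_simps)
    qed simp
    finally show "v' t \<le> (K + 2) * cmod b * v t" by (simp add: mult_ac)
  qed simp
  then show ?thesis by (simp add: v_def b_def)
qed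

section \<open>Factoring out zeros\<close>

definition zero_product :: "(complex \<Rightarrow> complex) \<Rightarrow> complex set \<Rightarrow> complex \<Rightarrow> complex" where
  "zero_product f Z z = (\<Prod>a\<in>Z. (z - a) ^ nat (zorder f a))"

lemma zero_product_holomorphic [holomorphic_intros]: "zero_product f Z holomorphic_on S"
  unfolding zero_product_def[abs_def] by (intro holomorphic_intros)

lemma norm_zero_product_le:
  assumes "\<And>a. a \<in> Z \<Longrightarrow> dist z a \<le> c"
  shows "cmod (zero_product f Z z) \<le> c ^ (\<Sum>a\<in>Z. nat (zorder f a))"
  unfolding zero_product_def prod_norm[symmetric] power_sum
  by (rule prod_mono) (use assms in \<open>auto simp: norm_power dist_norm intro!: power_mono\<close>)

lemma norm_zero_product_ge:
  assumes "\<And>a. a \<in> Z \<Longrightarrow> c \<le> dist z a" "c \<ge> 0"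
  shows "c ^ (\<Sum>a\<in>Z. nat (zorder f a)) \<le> cmod (zero_product f Z z)"
  unfolding zero_product_def prod_norm[symmetric] power_sum
  by (rule prod_mono) (use assms in \<open>auto simp: norm_power dist_norm intro!: power_mono\<close>)

text \<open>On the unit circle around \<open>w0\<close> the product has the same modulus as the reversed polynomial \<open>Q\<close>,
  and \<open>Q w0 = 1\<close>.\<close>

lemma norm_zero_product_ge_1_on_circle:
  obtains w where "dist w0 w = 1" "cmod (zero_product f Z w) \<ge> 1"
proof -
  define Q where "Q w = (\<Prod>a\<in>Z. (1 - cnj (a - w0) * (w - w0)) ^ nat (zorder f a))" for w
  have hol: "Q holomorphic_on UNIV" unfolding Q_def[abs_def] by (intro holomorphic_intros)
  then have cont: "continuous_on S Q" for S
    using holomorphic_on_imp_continuous_on continuous_on_subset by blast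
  have eq: "cmod (Q w) = cmod (zero_product f Z w)" if "dist w0 w = 1" for w
  proof -
    have "cmod (1 - cnj (a - w0) * (w - w0)) = cmod (w - a)" for a
    proof -
      have "(w - w0) * cnj (w - w0) = 1"
        using that complex_norm_square[of "w - w0"] by (simp only: dist_norm norm_minus_commute[of w0]) simp
      moreover have "(w - w0) * cnj (w - a) = (w - w0) * cnj (w - w0) - cnj (a - w0) * (w - w0)"
        by (simp add: algebra_simps)
      ultimately have "1 - cnj (a - w0) * (w - w0) = (w - w0) * cnj (w - a)" by (simp only:)
      then show ?thesis using that by (simp only: norm_mult complex_mod_cnj) (simp add: dist_norm norm_minus_commute)
    qed
    then show ?thesis
      unfolding Q_def zero_product_def prod_norm[symmetric] norm_power by simp
  qed
  have "compact (sphere w0 (1::real))" by simp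
  moreover have "sphere w0 (1::real) \<noteq> {}" by simp
  moreover have "continuous_on (sphere w0 1) (\<lambda>w. cmod (Q w))" by (intro continuous_intros cont)
  ultimately obtain w where w: "w \<in> sphere w0 1" "\<And>y. y \<in> sphere w0 1 \<Longrightarrow> cmod (Q y) \<le> cmod (Q w)"
    using continuous_attains_sup[of "sphere w0 1" "\<lambda>w. cmod (Q w)"] by blast
  have "cmod (Q w0) \<le> cmod (Q w)"
  proof (rule maximum_modulus_frontier[of Q "cball w0 1"])
    show "Q holomorphic_on interior (cball w0 1)" using hol holomorphic_on_subset by blast
  qed (use w in \<open>auto simp: cont\<close>)
  then have "cmod (Q w) \<ge> 1" by (simp add: Q_def)
  then show ?thesis using that[of w] w eq[of w] by simp
qed

text \<open>Induction over \<open>Z\<close>. Dividing the previous cofactor by the power of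
  \<open>z - b\<close> leaves a removable singularity at \<open>b\<close>: near \<open>b\<close> the
  quotient equals \<open>g / P\<close>, with \<open>g\<close> the local cofactor of
  \<open>f\<close>, nonzero at \<open>b\<close>, and \<open>P\<close> the product over the points
  already treated. Points of \<open>Z\<close> that are not zeros have order 0 and change
  nothing.\<close>

lemma entire_factor_out_zeros:
  assumes hol: "f holomorphic_on UNIV" and z1: "f z1 \<noteq> 0" and "finite Z"
  obtains F where "F holomorphic_on UNIV" "\<And>z. f z = zero_product f Z z * F z" "\<And>a. a \<in> Z \<Longrightarrow> F a \<noteq> 0"
proof -
  from \<open>finite Z\<close> have "\<exists>F. F holomorphic_on UNIV \<and> (\<forall>z. f z = zero_product f Z z * F z) \<and> (\<forall>a\<in>Z. F a \<noteq> 0)"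
  proof (induction Z)
    case empty
    then show ?case using hol by (intro exI[of _ f]) (simp add: zero_product_def)
  next
    case (insert b Z)
    then obtain F where F: "F holomorphic_on UNIV" "\<And>z. f z = zero_product f Z z * F z" "\<And>a. a \<in> Z \<Longrightarrow> F a \<noteq> 0"
      by blast
    define n where "n = nat (zorder f b)"
    define g where "g = zor_poly f b"
    have "\<exists>w\<in>UNIV. f w \<noteq> 0" using z1 by blast
    from zorder_exist_zero[OF hol open_UNIV connected_UNIV UNIV_I this, of b, folded g_def n_def]
    have "\<exists>r>0. cball b r \<subseteq> UNIV \<and> g holomorphic_on cball b r
        \<and> (\<forall>w\<in>cball b r. f w = g w * (w - b) ^ n \<and> g w \<noteq> 0)"
      by (rule conjunct2)
    then obtain r where r: "r > 0" "g holomorphic_on cball b r" "\<And>w. w \<in> cball b r \<Longrightarrow> f w = g w * (w - b) ^ n"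
        "\<And>w. w \<in> cball b r \<Longrightarrow> g w \<noteq> 0"
      by blast
    define P where "P = zero_product f Z"
    have Pb: "P b \<noteq> 0" using insert.hyps by (auto simp: P_def zero_product_def)
    have Pcont: "isCont P b"
      using zero_product_holomorphic[of f Z UNIV] holomorphic_on_imp_continuous_on continuous_on_eq_continuous_at open_UNIV
      unfolding P_def by blast
    define G where "G z = (if z = b then g b / P b else F z / (z - b) ^ n)" for z
    have eqG: "G w = g w / P w" if "w \<in> cball b r" "P w \<noteq> 0" for w
    proof (cases "w = b")
      case False
      have "F w * P w = g w * (w - b) ^ n" using r(3)[OF that(1)] F(2)[of w] by (simp add: P_def mult.commute)
      then show ?thesis using that(2) False by (simp add: G_def frac_eq_eq)
    qed (simp add: G_def)
    have "(G \<longlongrightarrow> G b) (at b)"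
    proof -
      have "isCont g b"
        using continuous_on_interior[OF holomorphic_on_imp_continuous_on[OF r(2)], of b] r(1) by simp
      then have "((\<lambda>w. g w / P w) \<longlongrightarrow> g b / P b) (at b)"
        unfolding isCont_def using Pcont[unfolded isCont_def] Pb by (rule tendsto_divide)
      moreover have "\<forall>\<^sub>F w in at b. g w / P w = G w"
      proof -
        have "\<forall>\<^sub>F w in at b. P w \<noteq> 0"
          using Pcont Pb by (simp add: isCont_def tendsto_imp_eventually_ne)
        moreover have "\<forall>\<^sub>F w in at b. w \<in> ball b r"
          using r(1) by (intro eventually_at_in_open') auto
        ultimately show ?thesis by eventually_elim (simp add: eqG)
      qed
      ultimately show ?thesis
        using Lim_transform_eventually[of "\<lambda>w. g w / P w" "g b / P b" "at b" G] by (simp add: G_def)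
    qed
    moreover have "G holomorphic_on (UNIV - {b})"
    proof -
      have "(\<lambda>z. F z / (z - b) ^ n) holomorphic_on (UNIV - {b})"
        by (intro holomorphic_intros holomorphic_on_subset[OF F(1)]) auto
      then show ?thesis by (rule holomorphic_transform) (auto simp: G_def)
    qed
    ultimately have "G holomorphic_on UNIV"
      using no_isolated_singularity'[where K = "{b}" and f = G and S = UNIV] by simp
    moreover have "f z = zero_product f (insert b Z) z * G z" for z
    proof -
      have "f z = (z - b) ^ n * P z * G z"
      proof (cases "z = b")
        case True
        then show ?thesis using r(3)[of b] r(1) Pb by (simp add: G_def)
      qed (use F(2)[of z] in \<open>simp add: G_def P_def\<close>)
      then show ?thesis using insert.hyps by (simp add: zero_product_def P_def n_def)
    qed
    moreover have "\<forall>a\<in>insert b Z. G a \<noteq> 0"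
      using F(3) r(1) r(4)[of b] Pb insert.hyps by (auto simp: G_def)
    ultimately show ?case by blast
  qed
  then show ?thesis using that by blast
qed

lemma finite_zeros_entire:
  assumes hol: "f holomorphic_on UNIV" and z1: "f z1 \<noteq> 0" and K: "bounded K"
  shows "finite {z \<in> K. f z = 0}"
proof (cases "f constant_on UNIV")
  case True
  then show ?thesis using z1 by (auto simp: constant_on_def)
next
  case False
  have "finite {z \<in> closure K. f z = 0}"
    using holomorphic_compact_finite_zeros[OF hol open_UNIV connected_UNIV _ _ False] K by auto
  then show ?thesis by (rule finite_subset[rotated]) (use closure_subset in auto)
qed

lemma multiplicity_sum_le_zero_count:
  assumes hol: "f holomorphic_on UNIV" and z1: "f z1 \<noteq> 0"
  shows "(\<Sum>a | dist z0 a \<le> R \<and> f a = 0. nat (zorder f a)) \<le> zero_count f (cmod z0 + R)"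
  unfolding zero_count_def
proof (rule sum_mono2)
  have "finite {z \<in> cball 0 (cmod z0 + R). f z = 0}" by (rule finite_zeros_entire[OF hol z1]) simp
  then show "finite {z. cmod z \<le> cmod z0 + R \<and> f z = 0}" by simp
  show "{a. dist z0 a \<le> R \<and> f a = 0} \<subseteq> {z. cmod z \<le> cmod z0 + R \<and> f z = 0}"
  proof safe
    fix a assume "dist z0 a \<le> R"
    then show "cmod a \<le> cmod z0 + R" using norm_triangle_ineq2[of a z0] by (simp add: dist_norm norm_minus_commute)
  qed
qed auto

lemma nonvanishing_factor_on_ball:
  assumes hol: "f holomorphic_on UNIV" and z1: "f z1 \<noteq> 0" and R: "R > 0"
  obtains Z F where "Z \<subseteq> cball z0 R" "(\<Sum>a\<in>Z. nat (zorder f a)) \<le> zero_count f (cmod z0 + R)"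
    "F holomorphic_on UNIV" "\<And>z. f z = zero_product f Z z * F z" "\<And>a. a \<in> cball z0 R \<Longrightarrow> F a \<noteq> 0"
proof -
  define Z where "Z = {a. dist z0 a \<le> R \<and> f a = 0}"
  have "finite {z \<in> cball z0 R. f z = 0}" by (rule finite_zeros_entire[OF hol z1]) simp
  then have fin: "finite Z" by (simp add: Z_def)
  obtain F where F: "F holomorphic_on UNIV" "\<And>z. f z = zero_product f Z z * F z" "\<And>a. a \<in> Z \<Longrightarrow> F a \<noteq> 0"
    using entire_factor_out_zeros[OF hol z1 fin] by blast
  have "F a \<noteq> 0" if "a \<in> cball z0 R" for a
  proof (cases "f a = 0")
    case True
    then have "a \<in> Z" using that by (simp add: Z_def)
    then show ?thesis by (rule F(3))
  next
    case False
    then show ?thesis using F(2)[of a] by auto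
  qed
  note nz = this
  show ?thesis
  proof (rule that)
    show "Z \<subseteq> cball z0 R" by (auto simp: Z_def)
    show "(\<Sum>a\<in>Z. nat (zorder f a)) \<le> zero_count f (cmod z0 + R)"
      unfolding Z_def by (rule multiplicity_sum_le_zero_count[OF hol z1])
  qed (fact F(1) F(2) nz)+
qed

text \<open>This splits ln |f| into ln |P|, which contributes at most \<open>N * ln (2 * R)\<close>,
  and the harmonic function Re g. The radius \<open>R + 1\<close> in the last property is where
  every zero in the closed ball is at distance at least 1, so that |P| \<ge> 1 and the zero-free
  cofactor is bounded by |f|; the maximum principle carries this inwards.\<close>

lemma local_factorization:
  assumes hol: "f holomorphic_on UNIV" and z1: "f z1 \<noteq> 0" and R: "R \<ge> 1"
  obtains N P g where "N \<le> zero_count f (cmod z0 + R)" "g holomorphic_on ball z0 R"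
    "\<And>w. w \<in> ball z0 R \<Longrightarrow> f w = P w * exp (g w)"
    "\<And>w. w \<in> ball z0 R \<Longrightarrow> cmod (P w) \<le> (2 * R) ^ N"
    "\<And>w0. \<exists>w. dist w0 w = 1 \<and> 1 \<le> cmod (P w)"
    "\<And>w M. w \<in> ball z0 R \<Longrightarrow> \<forall>u. dist z0 u \<le> R + 1 \<longrightarrow> cmod (f u) \<le> M \<Longrightarrow> exp (Re (g w)) \<le> M"
proof -
  obtain Z F where Z: "Z \<subseteq> cball z0 R" "(\<Sum>a\<in>Z. nat (zorder f a)) \<le> zero_count f (cmod z0 + R)"
    and F: "F holomorphic_on UNIV" "\<And>z. f z = zero_product f Z z * F z" "\<And>a. a \<in> cball z0 R \<Longrightarrow> F a \<noteq> 0"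
  proof (rule nonvanishing_factor_on_ball[where ?z0.0 = z0 and R = R, OF hol z1])
    show "R > 0" using R by simp
  qed (rule that)
  define N where "N = (\<Sum>a\<in>Z. nat (zorder f a))"
  obtain g where g: "g holomorphic_on ball z0 R" "\<And>w. w \<in> ball z0 R \<Longrightarrow> F w = exp (g w)"
  proof (rule contractible_imp_holomorphic_log[of F "ball z0 R"])
    show "F holomorphic_on ball z0 R" using F(1) holomorphic_on_subset by blast
    show "contractible (ball z0 R)" by (simp add: convex_imp_contractible)
  qed (use F(3) in auto)
  have "cmod (zero_product f Z w) \<le> (2 * R) ^ N" if "w \<in> ball z0 R" for w
    unfolding N_def
  proof (rule norm_zero_product_le)
    fix a assume "a \<in> Z"
    then have "dist z0 a \<le> R" using Z by auto
    then show "dist w a \<le> 2 * R" using that dist_triangle2[of w a z0] by (simp add: dist_commute)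
  qed
  moreover have "\<exists>w. dist w0 w = 1 \<and> 1 \<le> cmod (zero_product f Z w)" for w0
    using norm_zero_product_ge_1_on_circle[of w0 f Z] by blast
  moreover have "exp (Re (g w)) \<le> M"
    if w: "w \<in> ball z0 R" and M: "\<forall>u. dist z0 u \<le> R + 1 \<longrightarrow> cmod (f u) \<le> M" for w M
  proof -
    have "cmod (F w) \<le> M"
    proof (rule maximum_modulus_frontier[of F "cball z0 (R + 1)"])
      show "F holomorphic_on interior (cball z0 (R + 1))" using F(1) holomorphic_on_subset by blast
      show "continuous_on (closure (cball z0 (R + 1))) F"
        using F(1) holomorphic_on_imp_continuous_on holomorphic_on_subset by blast
      fix u assume "u \<in> frontier (cball z0 (R + 1))"
      then have u: "dist z0 u = R + 1" using R by (simp add: frontier_cball)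
      have "1 ^ N \<le> cmod (zero_product f Z u)"
        unfolding N_def
      proof (rule norm_zero_product_ge)
        fix a assume "a \<in> Z"
        then have "dist z0 a \<le> R" using Z by auto
        then show "1 \<le> dist u a" using u dist_triangle[of z0 u a] by (simp add: dist_commute)
      qed simp
      then have "1 * cmod (F u) \<le> cmod (zero_product f Z u) * cmod (F u)" by (intro mult_right_mono) auto
      also have "\<dots> = cmod (f u)" by (simp add: F(2) norm_mult)
      also have "\<dots> \<le> M" using M u by simp
      finally show "cmod (F u) \<le> M" by simp
    qed (use w in auto)
    then show ?thesis using g(2)[OF w] by simp
  qed
  moreover have "f w = zero_product f Z w * exp (g w)" if "w \<in> ball z0 R" for w
    using F(2)[of w] g(2)[OF that] by simp
  ultimately show ?thesis
    using that[of N g "zero_product f Z"] Z(2) g(1) unfolding N_def by blast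
qed

text \<open>A bound of Jensen type. Every counted zero is at distance at least \<open>3 * r\<close>
  from the circle of radius \<open>4 * r\<close> and at most \<open>2 * r\<close> from
  \<open>z1\<close>, so the maximum principle for the cofactor gains a factor 3/2 per zero.\<close>

lemma zero_count_le_maximum:
  assumes hol: "f holomorphic_on UNIV" and z1: "f z1 \<noteq> 0" and r: "cmod z1 \<le> r" "r > 0"
    and M: "\<And>w. cmod w = 4 * r \<Longrightarrow> cmod (f w) \<le> M"
  shows "(3 / 2) ^ zero_count f r * cmod (f z1) \<le> M"
proof -
  define Z where "Z = {a. cmod a \<le> r \<and> f a = 0}"
  have "finite {z \<in> cball 0 r. f z = 0}" by (rule finite_zeros_entire[OF hol z1]) simp
  then have fin: "finite Z" by (simp add: Z_def)
  obtain F where F: "F holomorphic_on UNIV" "\<And>z. f z = zero_product f Z z * F z" "\<And>a. a \<in> Z \<Longrightarrow> F a \<noteq> 0"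
    using entire_factor_out_zeros[OF hol z1 fin] by blast
  define N where "N = zero_count f r"
  have N: "N = (\<Sum>a\<in>Z. nat (zorder f a))" by (simp add: N_def zero_count_def Z_def)
  have up: "cmod (zero_product f Z z1) \<le> (2 * r) ^ N"
    unfolding N
  proof (rule norm_zero_product_le)
    fix a assume "a \<in> Z"
    then show "dist z1 a \<le> 2 * r" using r norm_triangle_ineq4[of z1 a] by (auto simp: Z_def dist_norm)
  qed
  have "cmod (F z1) \<le> M / (3 * r) ^ N"
  proof (rule maximum_modulus_frontier[of F "cball 0 (4 * r)"])
    show "F holomorphic_on interior (cball 0 (4 * r))" using F(1) holomorphic_on_subset by blast
    show "continuous_on (closure (cball 0 (4 * r))) F"
      using F(1) holomorphic_on_imp_continuous_on holomorphic_on_subset by blast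
    fix u assume "u \<in> frontier (cball 0 (4 * r) :: complex set)"
    then have u: "cmod u = 4 * r" using r by (simp add: frontier_cball)
    have "(3 * r) ^ N \<le> cmod (zero_product f Z u)"
      unfolding N
    proof (rule norm_zero_product_ge)
      fix a assume "a \<in> Z"
      then show "3 * r \<le> dist u a" using u norm_triangle_ineq2[of u a] by (auto simp: Z_def dist_norm)
    qed (use r in simp)
    then have "(3 * r) ^ N * cmod (F u) \<le> cmod (zero_product f Z u) * cmod (F u)" by (intro mult_right_mono) auto
    also have "\<dots> = cmod (f u)" by (simp add: F(2) norm_mult)
    also have "\<dots> \<le> M" using M u by simp
    finally show "cmod (F u) \<le> M / (3 * r) ^ N" using r by (simp add: field_simps)
  qed (use r in auto)
  then have "cmod (f z1) \<le> (2 * r) ^ N * (M / (3 * r) ^ N)"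
    using up r unfolding F(2)[of z1] norm_mult by (intro mult_mono) auto
  then have "(3 / 2) ^ N * cmod (f z1) \<le> (3 / 2) ^ N * ((2 * r) ^ N * (M / (3 * r) ^ N))"
    by (intro mult_left_mono) auto
  also have "\<dots> = M" using r by (simp add: power_mult_distrib power_divide)
  finally show ?thesis by (simp add: N_def)
qed

section \<open>The maximum modulus\<close>

lemma norm_le_max_modulus:
  assumes "f holomorphic_on UNIV" "cmod z \<le> r"
  shows "cmod (f z) \<le> max_modulus f r"
  unfolding max_modulus_def
proof (rule cSUP_upper)
  have "continuous_on (cball 0 r) (\<lambda>z. cmod (f z))"
    using assms(1) by (intro continuous_intros) (meson holomorphic_on_imp_continuous_on holomorphic_on_subset subset_UNIV)
  then have "compact ((\<lambda>z. cmod (f z)) ` cball 0 r)" by (intro compact_continuous_image) auto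
  then show "bdd_above ((\<lambda>z. cmod (f z)) ` cball 0 r)"
    by (intro bounded_imp_bdd_above compact_imp_bounded)
qed (use assms in auto)

lemma max_modulus_le:
  assumes "r \<ge> 0" "\<And>z. cmod z \<le> r \<Longrightarrow> cmod (f z) \<le> B"
  shows "max_modulus f r \<le> B"
  unfolding max_modulus_def by (rule cSUP_least) (use assms in auto)

lemma max_modulus_mono:
  assumes "f holomorphic_on UNIV" "0 \<le> r" "r \<le> s"
  shows "max_modulus f r \<le> max_modulus f s"
  by (rule max_modulus_le) (use assms in \<open>auto intro: norm_le_max_modulus\<close>)

lemma max_modulus_attained:
  assumes "f holomorphic_on UNIV" "r \<ge> 0"
  obtains z where "cmod z \<le> r" "cmod (f z) = max_modulus f r"
proof -
  have "continuous_on (cball 0 r) (\<lambda>z. cmod (f z))"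
    using assms(1) by (intro continuous_intros) (meson holomorphic_on_imp_continuous_on holomorphic_on_subset subset_UNIV)
  then obtain z where z: "z \<in> cball 0 r" "\<And>w. w \<in> cball 0 r \<Longrightarrow> cmod (f w) \<le> cmod (f z)"
    using continuous_attains_sup[of "cball 0 r" "\<lambda>z. cmod (f z)"] assms(2) by (metis cball_eq_empty compact_cball not_less)
  then have "max_modulus f r = cmod (f z)"
    using assms by (intro antisym max_modulus_le norm_le_max_modulus) auto
  then show ?thesis using z that by auto
qed

text \<open>The positive part keeps this nonnegative and monotone even while the maximum modulus is
  below 1, where \<open>ln\<close> would be negative or, at 0, a default value.\<close>

definition log_max_modulus :: "(complex \<Rightarrow> complex) \<Rightarrow> real \<Rightarrow> real" where
  "log_max_modulus f r = log_plus (max_modulus f r)"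

lemma log_plus_nonneg [simp]: "0 \<le> log_plus x"
  by (simp add: log_plus_def)

lemma le_exp_log_plus: "x \<le> exp (log_plus x)"
  by (simp add: log_plus_def)

lemma log_plus_mono: "x \<le> y \<Longrightarrow> log_plus x \<le> log_plus y"
  by (simp add: log_plus_def)

lemma log_max_modulus_nonneg [simp]: "0 \<le> log_max_modulus f r"
  by (simp add: log_max_modulus_def)

lemma norm_le_exp_log_max_modulus:
  assumes "f holomorphic_on UNIV" "cmod z \<le> r"
  shows "cmod (f z) \<le> exp (log_max_modulus f r)"
  using norm_le_max_modulus[OF assms] le_exp_log_plus order_trans unfolding log_max_modulus_def by blast

lemma log_max_modulus_mono:
  assumes "f holomorphic_on UNIV" "0 \<le> r" "r \<le> s"
  shows "log_max_modulus f r \<le> log_max_modulus f s"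
  unfolding log_max_modulus_def using max_modulus_mono[OF assms] by (rule log_plus_mono)

lemma log_max_modulus_le:
  assumes "r \<ge> 0" "B \<ge> 0" "\<And>z. cmod z \<le> r \<Longrightarrow> cmod (f z) \<le> exp B"
  shows "log_max_modulus f r \<le> B"
proof -
  have "max 1 (max_modulus f r) \<le> exp B" using max_modulus_le[OF assms(1,3)] assms(2) by simp
  then have "ln (max 1 (max_modulus f r)) \<le> ln (exp B)" by (subst ln_le_cancel_iff) auto
  then show ?thesis by (simp add: log_max_modulus_def log_plus_def)
qed

section \<open>Solutions with few zeros grow subexponentially\<close>

locale exponential_ode =
  fixes \<mu> \<nu> \<sigma> :: complex and f :: "complex \<Rightarrow> complex"
  assumes sigma: "\<sigma> \<noteq> 0"
    and hol: "f holomorphic_on UNIV"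
    and ode: "\<And>z. deriv (deriv f) z + (exp (2 * z) - \<nu>\<^sup>2) * f z = \<sigma> * exp ((\<mu> + 1) * z)"
begin

lemma hol': "f holomorphic_on S"
  using hol holomorphic_on_subset by blast

lemma not_identically_zero: obtains z where "f z \<noteq> 0"
proof (rule ccontr)
  assume "\<not> thesis"
  then have "f = (\<lambda>z. 0)" using that by auto
  then have "deriv (deriv f) 0 + (exp (2 * 0) - \<nu>\<^sup>2) * f 0 = 0" by simp
  then show False using ode[of 0] sigma by simp
qed

lemma norm_deriv2_le:
  "cmod (deriv (deriv f) z) \<le> (exp (2 * Re z) + (cmod \<nu>)\<^sup>2) * cmod (f z) + cmod \<sigma> * exp (cmod (\<mu> + 1) * cmod z)"
proof -
  have "deriv (deriv f) z = \<sigma> * exp ((\<mu> + 1) * z) - (exp (2 * z) - \<nu>\<^sup>2) * f z"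
    using ode[of z] by (simp add: algebra_simps)
  then have "cmod (deriv (deriv f) z) \<le> cmod (\<sigma> * exp ((\<mu> + 1) * z)) + cmod ((exp (2 * z) - \<nu>\<^sup>2) * f z)"
    by (metis norm_triangle_ineq4)
  moreover have "cmod (\<sigma> * exp ((\<mu> + 1) * z)) \<le> cmod \<sigma> * exp (cmod (\<mu> + 1) * cmod z)"
    using complex_Re_le_cmod[of "(\<mu> + 1) * z"] by (simp add: norm_mult mult_left_mono del: times_complex.sel)
  moreover have "cmod ((exp (2 * z) - \<nu>\<^sup>2) * f z) \<le> (exp (2 * Re z) + (cmod \<nu>)\<^sup>2) * cmod (f z)"
    using norm_triangle_ineq4[of "exp (2 * z)" "\<nu>\<^sup>2"] by (simp add: norm_mult norm_power mult_right_mono)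
  ultimately show ?thesis by linarith
qed

text \<open>Applied with \<open>K = exp (2 * cmod z)\<close> for the a priori bound, and with
  \<open>K = 1\<close> in the left half-plane. The right-hand side of the equation is replaced by
  its bound \<open>S\<close> on the whole segment, whose growth in |z| accounts for the summand
  \<open>2 * cmod (\<mu> + 1)\<close> in the exponent.\<close>

lemma gronwall_from_zero:
  assumes "K \<ge> 0" "\<And>w. w \<in> closed_segment 0 z \<Longrightarrow> exp (2 * Re w) \<le> K"
  shows "(cmod (f z))\<^sup>2 + (cmod (deriv f z))\<^sup>2
    \<le> ((cmod \<sigma>)\<^sup>2 + (cmod (f 0))\<^sup>2 + (cmod (deriv f 0))\<^sup>2)
        * exp ((2 * cmod (\<mu> + 1) + K + (cmod \<nu>)\<^sup>2 + 2) * cmod z)"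
proof -
  define S where "S = cmod \<sigma> * exp (cmod (\<mu> + 1) * cmod z)"
  have "cmod (deriv (deriv f) w) \<le> (K + (cmod \<nu>)\<^sup>2) * cmod (f w) + S" if w: "w \<in> closed_segment 0 z" for w
  proof -
    have "cmod w \<le> cmod z" using segment_bound1[OF w] by simp
    then have "cmod \<sigma> * exp (cmod (\<mu> + 1) * cmod w) \<le> S" unfolding S_def by (simp add: mult_left_mono)
    moreover have "(exp (2 * Re w) + (cmod \<nu>)\<^sup>2) * cmod (f w) \<le> (K + (cmod \<nu>)\<^sup>2) * cmod (f w)"
      using assms(2)[OF w] by (intro mult_right_mono) auto
    ultimately show ?thesis using norm_deriv2_le[of w] by linarith
  qed
  then have "S\<^sup>2 + (cmod (f z))\<^sup>2 + (cmod (deriv f z))\<^sup>2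
      \<le> (S\<^sup>2 + (cmod (f 0))\<^sup>2 + (cmod (deriv f 0))\<^sup>2) * exp ((K + (cmod \<nu>)\<^sup>2 + 2) * cmod (z - 0))"
    using assms(1) by (intro gronwall_second_order[OF hol]) (auto simp: S_def)
  also have "S\<^sup>2 + (cmod (f 0))\<^sup>2 + (cmod (deriv f 0))\<^sup>2
      \<le> ((cmod \<sigma>)\<^sup>2 + (cmod (f 0))\<^sup>2 + (cmod (deriv f 0))\<^sup>2) * exp (2 * cmod (\<mu> + 1) * cmod z)"
  proof -
    have "S\<^sup>2 = (cmod \<sigma>)\<^sup>2 * exp (2 * cmod (\<mu> + 1) * cmod z)"
      unfolding S_def power_mult_distrib by (simp add: exp_double[symmetric] mult.assoc)
    moreover have "x * 1 \<le> x * exp (2 * cmod (\<mu> + 1) * cmod z)" if "x \<ge> 0" for x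
      using that by (intro mult_left_mono) auto
    from this[of "(cmod (f 0))\<^sup>2"] this[of "(cmod (deriv f 0))\<^sup>2"]
    have "(cmod (f 0))\<^sup>2 \<le> (cmod (f 0))\<^sup>2 * exp (2 * cmod (\<mu> + 1) * cmod z)"
      "(cmod (deriv f 0))\<^sup>2 \<le> (cmod (deriv f 0))\<^sup>2 * exp (2 * cmod (\<mu> + 1) * cmod z)" by simp_all
    ultimately show ?thesis by (simp only: distrib_right)
  qed
  finally have "S\<^sup>2 + (cmod (f z))\<^sup>2 + (cmod (deriv f z))\<^sup>2
    \<le> ((cmod \<sigma>)\<^sup>2 + (cmod (f 0))\<^sup>2 + (cmod (deriv f 0))\<^sup>2)
        * exp ((2 * cmod (\<mu> + 1) + K + (cmod \<nu>)\<^sup>2 + 2) * cmod z)"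
    by (simp add: mult_right_mono mult.assoc exp_add[symmetric] distrib_right add_ac)
  then show ?thesis using zero_le_power2[of S] by linarith
qed

text \<open>Gronwall's exponent is of the order r exp (2 r), and r \<le> exp r turns it into exp (3
  r).\<close>

lemma a_priori_growth: obtains X where "X \<ge> 0" "\<And>r. r \<ge> 0 \<Longrightarrow> log_max_modulus f r \<le> X * exp (3 * r)"
proof -
  define V where "V = (cmod \<sigma>)\<^sup>2 + (cmod (f 0))\<^sup>2 + (cmod (deriv f 0))\<^sup>2"
  define Y where "Y = 2 * cmod (\<mu> + 1) + (cmod \<nu>)\<^sup>2 + 3"
  have V: "V \<ge> 0" by (simp add: V_def)
  have Y: "Y \<ge> 0" by (simp add: Y_def)
  have "cmod (f z) \<le> exp ((V + Y) * exp (3 * r))" if r: "r \<ge> 0" and z: "cmod z \<le> r" for z r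
  proof -
    have "exp (2 * Re w) \<le> exp (2 * cmod z)" if "w \<in> closed_segment 0 z" for w
      using segment_bound1[OF that] complex_Re_le_cmod[of w] by simp
    then have "(cmod (f z))\<^sup>2 + (cmod (deriv f z))\<^sup>2
      \<le> V * exp ((2 * cmod (\<mu> + 1) + exp (2 * cmod z) + (cmod \<nu>)\<^sup>2 + 2) * cmod z)"
      using gronwall_from_zero[of "exp (2 * cmod z)" z] unfolding V_def by auto
    also have "\<dots> \<le> V * exp (Y * exp (3 * r))"
    proof -
      have e1: "1 \<le> exp (2 * cmod z)" by simp
      have "2 * cmod (\<mu> + 1) + exp (2 * cmod z) + (cmod \<nu>)\<^sup>2 + 2 \<le> Y * exp (2 * cmod z)"
        using mult_left_mono[OF e1, of "Y - 1"] unfolding Y_def by (simp add: algebra_simps)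
      moreover have "cmod z \<le> exp (cmod z)" using exp_ge_add_one_self[of "cmod z"] by linarith
      ultimately have "(2 * cmod (\<mu> + 1) + exp (2 * cmod z) + (cmod \<nu>)\<^sup>2 + 2) * cmod z
          \<le> (Y * exp (2 * cmod z)) * exp (cmod z)"
        using Y by (intro mult_mono) auto
      also have "\<dots> = Y * exp (3 * cmod z)" by (simp add: mult.assoc exp_add[symmetric])
      also have "\<dots> \<le> Y * exp (3 * r)" using Y z by (intro mult_left_mono) auto
      finally show ?thesis using V by (intro mult_left_mono) auto
    qed
    also have "V * exp (Y * exp (3 * r)) \<le> exp (V * exp (3 * r)) * exp (Y * exp (3 * r))"
    proof (rule mult_right_mono)
      have "V * 1 \<le> V * exp (3 * r)" using V r by (intro mult_left_mono) auto
      also have "\<dots> \<le> exp (V * exp (3 * r))" using exp_ge_add_one_self[of "V * exp (3 * r)"] by linarith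
      finally show "V \<le> exp (V * exp (3 * r))" by simp
    qed simp
    also have "\<dots> \<le> (exp ((V + Y) * exp (3 * r)))\<^sup>2"
    proof -
      have "(V + Y) * exp (3 * r) \<ge> 0" using V Y by simp
      then show ?thesis by (simp add: exp_add[symmetric] exp_double[symmetric] distrib_right)
    qed
    finally have "(cmod (f z))\<^sup>2 \<le> (exp ((V + Y) * exp (3 * r)))\<^sup>2" by (smt (verit) zero_le_power2)
    then show ?thesis by (rule power2_le_imp_le) simp
  qed
  then have "log_max_modulus f r \<le> (V + Y) * exp (3 * r)" if "r \<ge> 0" for r
    using that V Y by (intro log_max_modulus_le) auto
  then show ?thesis using that[of "V + Y"] V Y by simp
qed

text \<open>If |f| \<le> \<open>\<eta>\<close> on the disc of radius \<open>\<delta>\<close> around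
  \<open>w\<close>, Cauchy's estimate gives |f''(w)| \<le> 2 \<open>\<eta>\<close> /
  \<open>\<delta>\<close>^2. Then the left side of the equation at \<open>w\<close> is at most D exp
  (2 |w|) \<open>\<eta>\<close>, while the right side is at least |\<open>\<sigma>\<close>| exp (- m
  |w|). The constant depends on \<open>\<delta>\<close> but not on \<open>w\<close>.\<close>

lemma not_small_near_any_point:
  assumes \<delta>: "\<delta> > 0"
  obtains C where "C \<ge> 0" "\<And>w. \<exists>w'. dist w w' \<le> \<delta> \<and> exp (- C * (cmod w + 1)) \<le> cmod (f w')"
proof -
  define D where "D = 2 / \<delta>\<^sup>2 + 1 + (cmod \<nu>)\<^sup>2"
  define m where "m = cmod (\<mu> + 1)"
  \<comment> \<open>The two rates add up to \<open>m + 2\<close>; one more unit makes the final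
    comparison strict, and the logarithm absorbs the constants of both sides.\<close>
  define C where "C = m + 3 + \<bar>ln (D / cmod \<sigma>)\<bar>"
  have D: "D > 0" using \<delta> by (simp add: D_def add_pos_nonneg)
  have s: "cmod \<sigma> > 0" using sigma by simp
  have m: "m \<ge> 0" by (simp add: m_def)
  have "\<exists>w'. dist w w' \<le> \<delta> \<and> exp (- C * (cmod w + 1)) \<le> cmod (f w')" for w
  proof (rule ccontr)
    assume neg: "\<not> ?thesis"
    define \<eta> where "\<eta> = exp (- C * (cmod w + 1))"
    have small: "cmod (f w') \<le> \<eta>" if "dist w w' \<le> \<delta>" for w' using neg that by (force simp: \<eta>_def)
    have "cmod ((deriv ^^ 2) f w) \<le> fact 2 * \<eta> / \<delta> ^ 2"
      by (rule Cauchy_inequality)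
         (use hol' \<delta> small in \<open>auto simp: dist_norm intro!: holomorphic_on_imp_continuous_on\<close>)
    then have d2: "cmod (deriv (deriv f) w) \<le> 2 * \<eta> / \<delta>\<^sup>2" by (simp add: numeral_2_eq_2)
    have e1: "1 \<le> exp (2 * cmod w)" by simp
    have re: "- (m * cmod w) \<le> Re ((\<mu> + 1) * w)"
      using abs_Re_le_cmod[of "(\<mu> + 1) * w"] by (simp only: norm_mult m_def)
    have "cmod \<sigma> * exp (- (m * cmod w)) \<le> cmod (\<sigma> * exp ((\<mu> + 1) * w))"
      using re by (simp add: norm_mult mult_left_mono del: times_complex.sel)
    also have "\<dots> \<le> cmod (deriv (deriv f) w) + cmod ((exp (2 * w) - \<nu>\<^sup>2) * f w)"
      unfolding ode[symmetric] by (rule norm_triangle_ineq)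
    also have "\<dots> \<le> 2 * \<eta> / \<delta>\<^sup>2 + (exp (2 * cmod w) + (cmod \<nu>)\<^sup>2) * \<eta>"
    proof -
      have "cmod (exp (2 * w) - \<nu>\<^sup>2) \<le> exp (2 * cmod w) + (cmod \<nu>)\<^sup>2"
        using norm_triangle_ineq4[of "exp (2 * w)" "\<nu>\<^sup>2"] complex_Re_le_cmod[of w]
        by (simp add: norm_power) (smt (verit) exp_le_cancel_iff)
      moreover have "cmod (f w) \<le> \<eta>" using small[of w] \<delta> by simp
      ultimately have "cmod ((exp (2 * w) - \<nu>\<^sup>2) * f w) \<le> (exp (2 * cmod w) + (cmod \<nu>)\<^sup>2) * \<eta>"
        unfolding norm_mult by (intro mult_mono) auto
      then show ?thesis using d2 by linarith
    qed
    also have "\<dots> = (2 / \<delta>\<^sup>2 + exp (2 * cmod w) + (cmod \<nu>)\<^sup>2) * \<eta>" by (simp add: algebra_simps)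
    also have "\<dots> \<le> (D * exp (2 * cmod w)) * \<eta>"
    proof (rule mult_right_mono)
      have "(2 / \<delta>\<^sup>2 + (cmod \<nu>)\<^sup>2) * 1 \<le> (2 / \<delta>\<^sup>2 + (cmod \<nu>)\<^sup>2) * exp (2 * cmod w)"
        using \<delta> by (intro mult_left_mono e1) simp
      then show "2 / \<delta>\<^sup>2 + exp (2 * cmod w) + (cmod \<nu>)\<^sup>2 \<le> D * exp (2 * cmod w)"
        unfolding D_def by (simp add: algebra_simps)
    qed (simp add: \<eta>_def)
    finally have "cmod \<sigma> * exp (- (m * cmod w)) \<le> D * exp (2 * cmod w) * \<eta>" .
    then have "ln (cmod \<sigma> * exp (- (m * cmod w))) \<le> ln (D * exp (2 * cmod w) * \<eta>)"
      using s D by (subst ln_le_cancel_iff) (auto simp: \<eta>_def)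
    then have "ln (cmod \<sigma>) - m * cmod w \<le> ln D + 2 * cmod w - C * (cmod w + 1)"
      using s D by (simp add: ln_mult_pos \<eta>_def)
    then have "C * (cmod w + 1) \<le> ln (D / cmod \<sigma>) + (m + 2) * cmod w"
      using s D by (simp add: ln_div algebra_simps)
    moreover have "(m + 2) * cmod w + \<bar>ln (D / cmod \<sigma>)\<bar> * 1 < (m + 3) * (cmod w + 1) + \<bar>ln (D / cmod \<sigma>)\<bar> * (cmod w + 1)"
      using m norm_ge_zero[of w]
      by (intro add_less_le_mono mult_left_mono) (simp_all add: algebra_simps add_pos_nonneg del: norm_ge_zero)
    ultimately show False unfolding C_def by (simp add: algebra_simps)
  qed
  moreover have "C \<ge> 0" using m by (simp add: C_def)
  ultimately show ?thesis using that by blast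
qed

end

text \<open>Near a point \<open>z0\<close> where \<open>|f|\<close> is maximal on \<open>|z| \<le> k\<close>, write \<open>f = P e\<^sup>g\<close> with \<open>P\<close> the monic polynomial of
  the zeros. Since \<open>f\<close> is not small at some point within \<open>\<delta>\<close> of any given point, Harnack's inequality
  bounds \<open>Re g\<close> from below by about \<open>-3 \<delta> log M(k + R + 1)\<close>; applied once more it carries the large
  value of \<open>Re g\<close> at \<open>z0\<close> over to a point of modulus at most \<open>k - 1\<close>.\<close>

lemma (in exponential_ode) growth_step:
  assumes R: "R \<ge> 6" and \<delta>: "0 < \<delta>" "\<delta> \<le> 1 / 3"
  obtains C where "C \<ge> 0"
    "\<And>k. k \<ge> 2 \<Longrightarrow> 1 \<le> max_modulus f k \<Longrightarrow>
      (1 - 6 / R) * log_max_modulus f k - 3 * \<delta> * log_max_modulus f (k + R + 1)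
        - 3 * (C * (k + R + 1) + real (zero_count f (k + R)) * ln (2 * R))
      \<le> log_max_modulus f (k - 1)"
proof -
  obtain z1 where z1: "f z1 \<noteq> 0" by (rule not_identically_zero)
  obtain C where C: "C \<ge> 0" "\<And>w. \<exists>w'. dist w w' \<le> \<delta> \<and> exp (- C * (cmod w + 1)) \<le> cmod (f w')"
    using not_small_near_any_point[OF \<delta>(1)] by blast
  have "(1 - 6 / R) * log_max_modulus f k - 3 * \<delta> * log_max_modulus f (k + R + 1)
        - 3 * (C * (k + R + 1) + real (zero_count f (k + R)) * ln (2 * R))
      \<le> log_max_modulus f (k - 1)"
    if k: "k \<ge> 2" and M1: "1 \<le> max_modulus f k" for k
  proof -
    obtain z0 where z0: "cmod z0 \<le> k" "cmod (f z0) = max_modulus f k"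
      using max_modulus_attained[OF hol, of k] k by auto
    have l_k: "ln (cmod (f z0)) = log_max_modulus f k"
      using M1 z0(2) by (simp add: log_max_modulus_def log_plus_def)
    define L where "L = log_max_modulus f (k + R + 1)"
    have L0: "L \<ge> 0" by (simp add: L_def)
    obtain N g P where N: "N \<le> zero_count f (cmod z0 + R)" and g: "g holomorphic_on ball z0 R"
      and fPg: "\<And>w. w \<in> ball z0 R \<Longrightarrow> f w = P w * exp (g w)"
      and P_le: "\<And>w. w \<in> ball z0 R \<Longrightarrow> cmod (P w) \<le> (2 * R) ^ N"
      and P_ge: "\<And>w0. \<exists>w. dist w0 w = 1 \<and> 1 \<le> cmod (P w)"
      and g_le: "\<And>w M. w \<in> ball z0 R \<Longrightarrow> \<forall>u. dist z0 u \<le> R + 1 \<longrightarrow> cmod (f u) \<le> M \<Longrightarrow> exp (Re (g w)) \<le> M"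
    proof (rule local_factorization[where ?z0.0 = z0 and R = R, OF hol z1])
      show "R \<ge> 1" using R by simp
    qed (rule that)
    define E where "E = C * (k + R + 1) + real (zero_count f (k + R)) * ln (2 * R)"
    have lnR: "ln (2 * R) \<ge> 0" using R by simp
    have E0: "E \<ge> 0" unfolding E_def using C(1) k R lnR by (intro add_nonneg_nonneg mult_nonneg_nonneg) auto
    have NE: "real N * ln (2 * R) \<le> E - C * (k + R + 1)"
    proof -
      have "zero_count f (cmod z0 + R) \<le> zero_count f (k + R)"
        unfolding zero_count_def
      proof (rule sum_mono2)
        have "finite {z \<in> cball 0 (k + R). f z = 0}" by (rule finite_zeros_entire[OF hol z1]) simp
        then show "finite {z. cmod z \<le> k + R \<and> f z = 0}" by simp
      qed (use z0 in auto)
      then have "real N \<le> real (zero_count f (k + R))" using N by simp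
      then have "real N * ln (2 * R) \<le> real (zero_count f (k + R)) * ln (2 * R)"
        using lnR by (rule mult_right_mono)
      then show ?thesis by (simp add: E_def)
    qed
    have in_disc: "cmod u \<le> k + s" if "dist z0 u \<le> s" for u s
      using that z0(1) norm_triangle_ineq2[of u z0] by (simp add: dist_norm norm_minus_commute)
    have g_le_L: "Re (g w) \<le> L" if "w \<in> ball z0 R" for w
    proof -
      have "exp (Re (g w)) \<le> exp L"
      proof (rule g_le[OF that], intro allI impI)
        fix u assume "dist z0 u \<le> R + 1"
        then have "cmod u \<le> k + R + 1" using in_disc[of u "R + 1"] by simp
        then show "cmod (f u) \<le> exp L" unfolding L_def by (rule norm_le_exp_log_max_modulus[OF hol])
      qed
      then show ?thesis by simp
    qed
    have ln_f_le: "ln (cmod (f w)) \<le> Re (g w) + real N * ln (2 * R)" if w: "w \<in> ball z0 R" "f w \<noteq> 0" for w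
    proof -
      have "cmod (f w) \<le> (2 * R) ^ N * exp (Re (g w))"
        unfolding fPg[OF w(1)] norm_mult norm_exp_eq_Re by (intro mult_right_mono P_le w) simp
      then have "ln (cmod (f w)) \<le> ln ((2 * R) ^ N * exp (Re (g w)))"
        using w(2) R by (subst ln_le_cancel_iff) auto
      also have "\<dots> = real N * ln (2 * R) + Re (g w)"
        using R by (simp add: ln_mult_pos ln_realpow distrib_left)
      finally show ?thesis by simp
    qed
    \<comment> \<open>Harnack's inequality for \<open>L - g\<close> on a unit ball, at distance at
      most \<open>\<delta>\<close>, costs the factor (1 + \<open>\<delta>\<close>) / (1 -
      \<open>\<delta>\<close>) \<le> 1 + 3 \<open>\<delta>\<close>; this uses
      \<open>\<delta>\<close> \<le> 1/3. From L - Re g \<le> (1 + 3 \<open>\<delta>\<close>) (L + E)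
      the lower bound \<open>- B\<close> follows.\<close>
    define B where "B = 3 * \<delta> * L + 2 * E"
    have B0: "B \<ge> 0" using \<delta> L0 E0 by (simp add: B_def)
    have g_ge: "- B \<le> Re (g z)" if z: "z \<in> ball z0 (R - 1)" for z
    proof -
      have sub: "ball z 1 \<subseteq> ball z0 R"
      proof
        fix u assume "u \<in> ball z 1"
        then show "u \<in> ball z0 R" using z dist_triangle[of z0 u z] by simp
      qed
      obtain w where w: "dist z w \<le> \<delta>" "exp (- C * (cmod z + 1)) \<le> cmod (f w)" using C(2) by blast
      have wz: "w \<in> ball z 1" using w(1) \<delta>(2) by simp
      have fw: "f w \<noteq> 0" using w(2) exp_gt_zero[of "- C * (cmod z + 1)"] by auto
      have "cmod z \<le> k + R" using in_disc[of z R] z by simp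
      then have "C * (cmod z + 1) \<le> C * (k + R + 1)" using C(1) by (intro mult_left_mono) auto
      moreover have "ln (exp (- C * (cmod z + 1))) \<le> ln (cmod (f w))"
        using w(2) fw by (subst ln_le_cancel_iff) auto
      ultimately have "- E \<le> Re (g w)"
        using ln_f_le[of w] wz sub fw NE by auto
      define G where "G u = of_real L - g u" for u
      have "G holomorphic_on ball z 1" unfolding G_def[abs_def]
        by (intro holomorphic_intros holomorphic_on_subset[OF g sub])
      moreover have G0: "Re (G u) \<ge> 0" if "u \<in> ball z 1" for u
        using g_le_L[of u] sub that by (auto simp: G_def)
      ultimately have harn: "(1 - dist z w) * Re (G z) \<le> (1 + dist z w) * Re (G w)"
        using harnack(1)[of G z 1 w] wz by blast
      have "(1 - \<delta>) * Re (G z) \<le> (1 - dist z w) * Re (G z)" using w(1) G0[of z] by (intro mult_right_mono) auto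
      also note harn
      also have "(1 + dist z w) * Re (G w) \<le> (1 + \<delta>) * Re (G w)" using w(1) G0[OF wz] by (intro mult_right_mono) auto
      also have "\<dots> \<le> (1 + \<delta>) * (L + E)" using \<open>- E \<le> Re (g w)\<close> \<delta> by (intro mult_left_mono) (auto simp: G_def)
      also have "\<dots> \<le> (1 - \<delta>) * (1 + 3 * \<delta>) * (L + E)"
      proof (rule mult_right_mono)
        have "\<delta> * (3 * \<delta>) \<le> \<delta> * 1" using \<delta> by (intro mult_left_mono) auto
        then show "1 + \<delta> \<le> (1 - \<delta>) * (1 + 3 * \<delta>)" by (simp add: algebra_simps)
      qed (use L0 E0 in simp)
      finally have "(1 - \<delta>) * Re (G z) \<le> (1 - \<delta>) * ((1 + 3 * \<delta>) * (L + E))" by (simp add: mult.assoc)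
      then have "Re (G z) \<le> (1 + 3 * \<delta>) * (L + E)" using \<delta> by (subst (asm) mult_le_cancel_left_pos) auto
      moreover have "3 * \<delta> * E \<le> 1 * E" using \<delta> E0 by (intro mult_right_mono) auto
      ultimately show ?thesis unfolding B_def G_def by (simp add: algebra_simps)
    qed
    \<comment> \<open>Moving \<open>z0\<close> towards the origin by at most 2 gives modulus at most
      \<open>k - 2\<close>, so a point \<open>w\<close> on the unit circle around \<open>w0\<close>
      with |P w| \<ge> 1 still lies in the disc of radius \<open>k - 1\<close>, at distance at most
      3 from \<open>z0\<close>.\<close>
    define w0 where "w0 = of_real (1 - 2 / k) * z0"
    obtain w where w: "dist w0 w = 1" "1 \<le> cmod (P w)" using P_ge by blast
    have "0 \<le> 1 - 2 / k" using k by simp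
    then have "cmod w0 = (1 - 2 / k) * cmod z0" by (simp only: w0_def norm_mult norm_of_real abs_of_nonneg)
    also have "\<dots> \<le> (1 - 2 / k) * k" using k z0(1) by (intro mult_left_mono) (auto simp: field_simps)
    also have "\<dots> = k - 2" using k by (simp add: field_simps)
    finally have w0k: "cmod w0 \<le> k - 2" .
    have wk: "cmod w \<le> k - 1" using w0k w(1) norm_triangle_ineq2[of w w0] by (simp add: dist_norm norm_minus_commute)
    have "z0 - w0 = of_real (2 / k) * z0" by (simp add: w0_def algebra_simps)
    then have "dist z0 w0 = 2 / k * cmod z0" using k by (simp only: dist_norm norm_mult norm_of_real) simp
    also have "\<dots> \<le> 2 / k * k" using k z0(1) by (intro mult_left_mono) auto
    finally have "dist z0 w0 \<le> 2" using k by simp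
    then have d3: "dist z0 w \<le> 3" using w(1) dist_triangle[of z0 w w0] by simp
    have wR: "w \<in> ball z0 R" "w \<in> ball z0 (R - 1)" using d3 R by auto
    define H where "H u = g u + of_real B" for u
    have "H holomorphic_on ball z0 (R - 1)" unfolding H_def[abs_def]
      by (intro holomorphic_intros holomorphic_on_subset[OF g]) auto
    moreover have H0: "Re (H u) \<ge> 0" if "u \<in> ball z0 (R - 1)" for u
      using g_ge[OF that] by (simp add: H_def)
    \<comment> \<open>With distance at most 3 in a ball of radius \<open>R - 1\<close>, Harnack's
      factor is at least (R - 4) / (R + 2) = 1 - 6 / (R + 2).\<close>
    ultimately have harn: "(R - 1 - dist z0 w) * Re (H z0) \<le> (R - 1 + dist z0 w) * Re (H w)"
      using harnack(1)[of H z0 "R - 1" w] wR(2) by blast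
    have Hz0: "Re (H z0) \<ge> 0" using H0[of z0] R by simp
    have "(R - 4) * Re (H z0) \<le> (R - 1 - dist z0 w) * Re (H z0)" using d3 Hz0 by (intro mult_right_mono) auto
    also note harn
    also have "(R - 1 + dist z0 w) * Re (H w) \<le> (R + 2) * Re (H w)" using d3 H0[OF wR(2)] by (intro mult_right_mono) auto
    finally have "(R - 4) / (R + 2) * Re (H z0) \<le> Re (H w)" using R by (simp add: field_simps)
    moreover have "(1 - 6 / R) * Re (H z0) \<le> (R - 4) / (R + 2) * Re (H z0)"
      using R Hz0 by (intro mult_right_mono) (auto simp: field_simps)
    ultimately have Hw: "(1 - 6 / R) * Re (H z0) \<le> Re (H w)" by linarith
    have lk0: "log_max_modulus f k \<ge> 0" by simp
    have "f z0 \<noteq> 0" using z0(2) M1 by auto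
    have gz0: "log_max_modulus f k \<le> Re (H z0) + E"
    proof -
      have "0 \<le> C * (k + R + 1)" using C(1) k R by simp
      moreover have "log_max_modulus f k \<le> Re (g z0) + real N * ln (2 * R)"
        using ln_f_le[of z0] \<open>f z0 \<noteq> 0\<close> R l_k by simp
      ultimately show ?thesis using NE B0 by (simp add: H_def)
    qed
    have "(1 - 6 / R) * log_max_modulus f k \<le> (1 - 6 / R) * Re (H z0) + E"
    proof -
      have "(1 - 6 / R) * log_max_modulus f k \<le> (1 - 6 / R) * (Re (H z0) + E)"
        using gz0 R by (intro mult_left_mono) auto
      moreover have "(1 - 6 / R) * E \<le> 1 * E" using E0 R by (intro mult_right_mono) auto
      ultimately show ?thesis by (simp add: distrib_left)
    qed
    moreover have "Re (g w) \<le> log_max_modulus f (k - 1)"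
    proof -
      have "1 * exp (Re (g w)) \<le> cmod (P w) * exp (Re (g w))" using w(2) by (intro mult_right_mono) auto
      also have "\<dots> = cmod (f w)" by (simp add: fPg[OF wR(1)] norm_mult)
      also have "\<dots> \<le> exp (log_max_modulus f (k - 1))" by (rule norm_le_exp_log_max_modulus[OF hol wk])
      finally show ?thesis by simp
    qed
    \<comment> \<open>One \<open>E\<close> is the cost of passing from ln |f z0| to Re (g z0); the
      other two come from \<open>B\<close>.\<close>
    ultimately show ?thesis using Hw unfolding H_def B_def L_def[symmetric] E_def[symmetric] by simp
  qed
  then show ?thesis using that C(1) by blast
qed

lemma polynomial_times_exp_tendsto_0:
  "(\<lambda>k::nat. real (k + 1) ^ q / exp (real (k + 1))) \<longlonglongrightarrow> 0"
proof -
  have "filterlim (\<lambda>k::nat. real (k + 1)) at_top sequentially"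
    using filterlim_compose[OF filterlim_real_sequentially filterlim_Suc] by simp
  from filterlim_compose[OF tendsto_power_div_exp_0[of q] this] show ?thesis .
qed

text \<open>The sequence \<open>A\<close> adds to the logarithm a power of higher degree than the
  error in \<open>growth_step\<close>. At a peak of the weighted sequence the error then disappears,
  and \<open>slow_growth_of_peak_growth\<close> yields a growth factor of at most
  \<open>exp e\<close> per unit step.\<close>

lemma (in exponential_ode) log_max_modulus_subexponential:
  assumes zeros: "\<And>r. r \<ge> r1 \<Longrightarrow> real (zero_count f r) \<le> r ^ p" and \<epsilon>: "\<epsilon> > 0"
  obtains C where "\<And>r. r \<ge> 0 \<Longrightarrow> log_max_modulus f r \<le> C * exp (\<epsilon> * r)"
proof (cases "\<exists>k0\<ge>0. max_modulus f k0 \<ge> 1")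
  case False
  have "log_max_modulus f r \<le> 0 * exp (\<epsilon> * r)" if "r \<ge> 0" for r
  proof -
    have "max_modulus f r < 1" using False that by force
    then show ?thesis by (simp add: log_max_modulus_def log_plus_def)
  qed
  then show ?thesis by (rule that)
next
  case True
  then obtain k0 where k0: "k0 \<ge> 0" "max_modulus f k0 \<ge> 1" by blast
  have M1: "max_modulus f k \<ge> 1" if "k \<ge> k0" for k
    using max_modulus_mono[OF hol, of k0 k] k0 that by linarith
  \<comment> \<open>Capping the rate at 1 guarantees \<open>(1 - h) * exp 4 > 1\<close>
    below.\<close>
  define e where "e = min \<epsilon> 1"
  have e: "0 < e" "e \<le> 1" "e \<le> \<epsilon>" using \<epsilon> by (auto simp: e_def)
  define h where "h = 1 - exp (- e)"
  have h: "0 < h" "h < 1" using e by (auto simp: h_def)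
  \<comment> \<open>Half of the loss \<open>h\<close> pays for Harnack's factor, since 6/R \<le>
    h/2; the other half is reserved for the term at radius \<open>k + R + 1\<close>.\<close>
  define R where "R = 12 / h + 6"
  have R: "R \<ge> 6" using h by (simp add: R_def)
  have Rh: "6 / R \<le> h / 2" using h unfolding R_def by (simp add: field_simps)
  define m where "m = nat \<lceil>R\<rceil> + 1"
  have m: "R + 1 \<le> real m" unfolding m_def by linarith
  \<comment> \<open>At a peak the far term is at most \<open>exp (4 * real m) * A k\<close>; this
    choice makes its contribution at most \<open>h / 2 * A k\<close>.\<close>
  define \<delta> where "\<delta> = min (1 / 3) (h / 6 * exp (- 4 * real m))"
  have \<delta>: "0 < \<delta>" "\<delta> \<le> 1 / 3" using h by (auto simp: \<delta>_def)
  have \<delta>h: "3 * \<delta> * exp (4 * real m) \<le> h / 2"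
  proof -
    have "3 * \<delta> * exp (4 * real m) \<le> 3 * (h / 6 * exp (- 4 * real m)) * exp (4 * real m)"
      unfolding \<delta>_def by (intro mult_right_mono mult_left_mono) auto
    also have "\<dots> = h / 2" by (simp add: mult.assoc exp_add[symmetric])
    finally show ?thesis .
  qed
  obtain C where C: "C \<ge> 0" "\<And>k. k \<ge> 2 \<Longrightarrow> 1 \<le> max_modulus f k \<Longrightarrow>
      (1 - 6 / R) * log_max_modulus f k - 3 * \<delta> * log_max_modulus f (k + R + 1)
        - 3 * (C * (k + R + 1) + real (zero_count f (k + R)) * ln (2 * R))
      \<le> log_max_modulus f (k - 1)"
    using growth_step[OF R \<delta>] by blast
  define q where "q = p + 2"
  define A where "A k = log_max_modulus f (real k) + (real k + 1) ^ q" for k :: nat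
  define D where "D = 3 * (C + ln (2 * R)) * (R + 1) ^ (p + 1)"
  have lnR: "ln (2 * R) \<ge> 0" using R by simp
  have error_le: "3 * (C * (k + R + 1) + real (zero_count f (k + R)) * ln (2 * R)) \<le> D * (k + 1) ^ (p + 1)"
    if k: "k \<ge> max r1 0" for k
  proof -
    have "real (zero_count f (k + R)) \<le> (k + R) ^ p" using zeros[of "k + R"] k R by simp
    also have "\<dots> \<le> (k + R + 1) ^ p" using k R by (intro power_mono) auto
    also have "\<dots> \<le> (k + R + 1) ^ (p + 1)" using k R by (intro power_increasing) auto
    finally have z: "real (zero_count f (k + R)) \<le> (k + R + 1) ^ (p + 1)" .
    have "(k + R + 1) ^ 1 \<le> (k + R + 1) ^ (p + 1)" using k R by (intro power_increasing) auto
    then have "C * (k + R + 1) + real (zero_count f (k + R)) * ln (2 * R)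
        \<le> C * (k + R + 1) ^ (p + 1) + (k + R + 1) ^ (p + 1) * ln (2 * R)"
      using C(1) z lnR by (intro add_mono mult_left_mono mult_right_mono) auto
    also have "\<dots> = (C + ln (2 * R)) * (k + R + 1) ^ (p + 1)" by (simp only: distrib_right mult.commute)
    also have "\<dots> \<le> (C + ln (2 * R)) * ((R + 1) * (k + 1)) ^ (p + 1)"
    proof (intro mult_left_mono power_mono)
      have "0 \<le> R * k" using R k by simp
      then show "k + R + 1 \<le> (R + 1) * (k + 1)" by (simp add: algebra_simps)
    qed (use C(1) lnR k R in auto)
    also have "3 * \<dots> = D * (k + 1) ^ (p + 1)" by (simp only: D_def power_mult_distrib mult.assoc)
    finally show ?thesis by simp
  qed
  have pos: "A k > 0" for k
    unfolding A_def by (intro add_nonneg_pos) auto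
  \<comment> \<open>The weight has rate 4, which beats the a priori rate 3 and the added
    power.\<close>
  have lim: "(\<lambda>k. A k * exp (- 4 * real k)) \<longlonglongrightarrow> 0"
  proof -
    obtain X where X: "X \<ge> 0" "\<And>r. r \<ge> 0 \<Longrightarrow> log_max_modulus f r \<le> X * exp (3 * r)"
      using a_priori_growth by blast
    let ?U = "\<lambda>k::nat. X * exp (- real k) + exp 1 * (real (k + 1) ^ q / exp (real (k + 1)))"
    have "filterlim (\<lambda>k::nat. - real k) at_bot sequentially"
      using filterlim_real_sequentially by (simp add: filterlim_uminus_at_top)
    from filterlim_compose[OF exp_at_bot this] have "?U \<longlonglongrightarrow> X * 0 + exp 1 * 0"
      by (intro tendsto_intros polynomial_times_exp_tendsto_0)
    then have U: "?U \<longlonglongrightarrow> 0" by simp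
    have le: "A k * exp (- 4 * real k) \<le> ?U k" for k
    proof -
      have "log_max_modulus f (real k) * exp (- 4 * real k) \<le> X * exp (3 * real k) * exp (- 4 * real k)"
        by (intro mult_right_mono X(2)) auto
      also have "\<dots> = X * exp (- real k)" by (simp add: mult.assoc exp_add[symmetric])
      finally have 1: "log_max_modulus f (real k) * exp (- 4 * real k) \<le> X * exp (- real k)" .
      have "(real k + 1) ^ q * exp (- 4 * real k) \<le> (real k + 1) ^ q * exp (- real k)"
        by (intro mult_left_mono) auto
      also have "\<dots> = exp 1 * (real (k + 1) ^ q / exp (real (k + 1)))"
        by (simp add: exp_add exp_minus field_simps)
      finally show ?thesis using 1 unfolding A_def distrib_right by linarith
    qed
    show ?thesis
      by (rule real_tendsto_sandwich[OF _ _ tendsto_const[of 0] U])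
         (use pos le in \<open>auto intro!: always_eventually mult_nonneg_nonneg less_imp_le\<close>)
  qed
  have "\<forall>\<^sub>F k in sequentially. D / real (Suc k) < (real k / real (Suc k)) ^ q - (1 - h / 2)"
  proof -
    have "(\<lambda>k. D / real (Suc k)) \<longlonglongrightarrow> 0"
      using LIMSEQ_Suc[OF lim_const_over_n[of D]] by simp
    moreover have "(\<lambda>k. (real k / real (Suc k)) ^ q - (1 - h / 2)) \<longlonglongrightarrow> 1 ^ q - (1 - h / 2)"
      by (intro tendsto_intros LIMSEQ_n_over_Suc_n)
    ultimately have "(\<lambda>k. (real k / real (Suc k)) ^ q - (1 - h / 2) - D / real (Suc k)) \<longlonglongrightarrow> 1 ^ q - (1 - h / 2) - 0"
      by (rule tendsto_diff[rotated])
    moreover have "0 < 1 ^ q - (1 - h / 2) - 0" using h by simp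
    ultimately have "\<forall>\<^sub>F k in sequentially. 0 < (real k / real (Suc k)) ^ q - (1 - h / 2) - D / real (Suc k)"
      by (rule order_tendstoD(1))
    then show ?thesis by eventually_elim simp
  qed
  then obtain N0 where N0: "\<And>k. k \<ge> N0 \<Longrightarrow> D / real (Suc k) < (real k / real (Suc k)) ^ q - (1 - h / 2)"
    by (auto simp: eventually_sequentially)
  define N where "N = max N0 (max 2 (nat \<lceil>max r1 k0\<rceil>))"
  have N: "k \<ge> N0" "real k \<ge> 2" "real k \<ge> r1" "real k \<ge> k0" "k \<ge> 2" if "k \<ge> N" for k
    using that unfolding N_def by (auto simp: nat_ceiling_le_eq)
  \<comment> \<open>After division by the power \<open>q = p + 2\<close> of \<open>k + 1\<close>,
    the error becomes \<open>D / (k + 1)\<close>, which tends to 0, while the right side tends to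
    \<open>h / 2\<close>.\<close>
  have gap: "D * (real k + 1) ^ (p + 1) \<le> real k ^ q - (1 - h / 2) * (real k + 1) ^ q" if "k \<ge> N" for k
  proof -
    let ?x = "real k + 1"
    have x: "?x > 0" by simp
    have "?x ^ q * (D / ?x) \<le> ?x ^ q * ((real k / ?x) ^ q - (1 - h / 2))"
      using N0[OF N(1)[OF that]] by (intro mult_left_mono) (simp_all add: add.commute)
    moreover have "?x ^ q * (D / ?x) = D * ?x ^ (p + 1)" using x by (simp add: q_def)
    moreover have "?x ^ q * ((real k / ?x) ^ q - (1 - h / 2)) = real k ^ q - (1 - h / 2) * ?x ^ q"
      using x by (simp add: right_diff_distrib power_divide mult.commute)
    ultimately show ?thesis by simp
  qed
  have step: "(1 - h) * A k \<le> A (k - 1)" if k: "k \<ge> N" and peak: "A (k + m) \<le> exp (4 * real m) * A k" for k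
  proof -
    let ?l = "log_max_modulus f"
    have "?l (real k + R + 1) \<le> ?l (real (k + m))" using m R by (intro log_max_modulus_mono hol) auto
    also have "\<dots> \<le> A (k + m)" by (simp add: A_def)
    finally have "?l (real k + R + 1) \<le> exp (4 * real m) * A k" using peak by linarith
    then have "3 * \<delta> * ?l (real k + R + 1) \<le> 3 * \<delta> * (exp (4 * real m) * A k)"
      using \<delta> by (intro mult_left_mono) auto
    also have "\<dots> \<le> h / 2 * A k"
      using mult_right_mono[OF \<delta>h, of "A k"] pos[of k] by (simp add: mult.assoc)
    finally have far: "3 * \<delta> * ?l (real k + R + 1) \<le> h / 2 * A k" .
    have near: "(1 - h / 2) * ?l (real k) \<le> (1 - 6 / R) * ?l (real k)"
      using Rh by (intro mult_right_mono) auto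
    have "(1 - 6 / R) * ?l (real k) - h / 2 * A k - D * (real k + 1) ^ (p + 1) \<le> ?l (real k - 1)"
      using C(2)[of "real k"] N[OF k] M1[of "real k"] far error_le[of "real k"] by simp
    moreover have "A (k - 1) = ?l (real k - 1) + real k ^ q"
      using N(5)[OF k] by (simp add: A_def of_nat_diff)
    ultimately have "(1 - h / 2) * ?l (real k) + (1 - h / 2) * (real k + 1) ^ q - h / 2 * A k \<le> A (k - 1)"
      using near gap[OF k] by linarith
    then show ?thesis unfolding A_def[of k] by (simp add: algebra_simps)
  qed
  have h4: "(1 - h) * exp 4 > 1" using e by (simp add: h_def exp_add[symmetric])
  have slow: "A n \<le> exp e * A (n - 1)" if "n \<ge> N" for n
  proof -
    have "(1 - h) * A n \<le> A (n - 1)"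
      by (rule slow_growth_of_peak_growth[where c = 4 and N = N and m = m, OF pos lim h4 step])
         (use that N(5)[OF that] in auto)
    then have "exp e * ((1 - h) * A n) \<le> exp e * A (n - 1)" by (intro mult_left_mono) auto
    then show ?thesis by (simp add: h_def mult.assoc[symmetric] exp_add[symmetric])
  qed
  have AN: "A n \<le> A N * exp (e * real n)" if "n \<ge> N" for n
    using that
  proof (induction n rule: dec_induct)
    case base
    have "A N * 1 \<le> A N * exp (e * real N)" using pos[of N] e by (intro mult_left_mono) auto
    then show ?case by simp
  next
    case (step n)
    have "A (Suc n) \<le> exp e * A n" using slow[of "Suc n"] step by simp
    also have "\<dots> \<le> exp e * (A N * exp (e * real n))" using step by (intro mult_left_mono) auto
    also have "\<dots> = A N * exp (e * real (Suc n))" by (simp add: exp_add distrib_left)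
    finally show ?case .
  qed
  have "log_max_modulus f r \<le> (A N * exp (e * (real N + 1))) * exp (\<epsilon> * r)" if r: "r \<ge> 0" for r
  proof -
    define n where "n = N + nat \<lceil>r\<rceil>"
    have n: "r \<le> real n" "real n \<le> real N + 1 + r" using r unfolding n_def by linarith+
    have "log_max_modulus f r \<le> log_max_modulus f (real n)" using n r by (intro log_max_modulus_mono hol) auto
    also have "\<dots> \<le> A n" by (simp add: A_def)
    also have "\<dots> \<le> A N * exp (e * real n)" by (rule AN) (simp add: n_def)
    also have "\<dots> \<le> A N * exp (e * (real N + 1) + \<epsilon> * r)"
    proof -
      have "e * real n \<le> e * (real N + 1 + r)" using e n by (intro mult_left_mono) auto
      also have "\<dots> = e * (real N + 1) + e * r" by (simp add: algebra_simps)
      also have "e * r \<le> \<epsilon> * r" using e r by (intro mult_right_mono) auto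
      finally show ?thesis using pos[of N] by (intro mult_left_mono) auto
    qed
    finally show ?thesis by (simp add: exp_add mult.assoc)
  qed
  then show ?thesis by (rule that)
qed

section \<open>Maximum modulus and proximity function\<close>

text \<open>For positive \<open>R\<close> these are the real trigonometric polynomials on the
  circle. Writing them as real parts of polynomials supplies their harmonic extension to the
  disc.\<close>

definition harmonic_polynomial_on_circle :: "real \<Rightarrow> (complex \<Rightarrow> real) \<Rightarrow> bool" where
  "harmonic_polynomial_on_circle R u \<longleftrightarrow> (\<exists>p. \<forall>z. cmod z = R \<longrightarrow> u z = Re (poly p z))"

lemma harmonic_polynomial_on_circleI:
  "(\<And>z. cmod z = R \<Longrightarrow> u z = Re (poly p z)) \<Longrightarrow> harmonic_polynomial_on_circle R u"
  by (auto simp: harmonic_polynomial_on_circle_def)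

lemma harmonic_polynomial_on_circle_cong:
  "(\<And>z. cmod z = R \<Longrightarrow> u z = v z) \<Longrightarrow> harmonic_polynomial_on_circle R v \<Longrightarrow> harmonic_polynomial_on_circle R u"
  by (auto simp: harmonic_polynomial_on_circle_def)

lemma harmonic_polynomial_on_circle_add:
  assumes "harmonic_polynomial_on_circle R u" "harmonic_polynomial_on_circle R v"
  shows "harmonic_polynomial_on_circle R (\<lambda>z. u z + v z)"
proof -
  obtain p q where "\<forall>z. cmod z = R \<longrightarrow> u z = Re (poly p z)" "\<forall>z. cmod z = R \<longrightarrow> v z = Re (poly q z)"
    using assms by (auto simp: harmonic_polynomial_on_circle_def)
  then show ?thesis by (intro harmonic_polynomial_on_circleI[of _ _ "p + q"]) simp
qed

lemma harmonic_polynomial_on_circle_sum: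
  assumes "finite I" "\<And>i. i \<in> I \<Longrightarrow> harmonic_polynomial_on_circle R (u i)"
  shows "harmonic_polynomial_on_circle R (\<lambda>z. \<Sum>i\<in>I. u i z)"
  using assms
proof (induction I)
  case empty
  then show ?case by (intro harmonic_polynomial_on_circleI[of _ _ 0]) simp
qed (simp add: harmonic_polynomial_on_circle_add)

text \<open>This makes the class an algebra. Re x Re y is half of Re (x y) + Re (x cnj y), and on
  the circle z cnj z is the constant R^2, so for j \<le> i the conjugated power only lowers the
  exponent to \<open>i - j\<close>.\<close>

lemma harmonic_polynomial_on_circle_mult_monom:
  "harmonic_polynomial_on_circle R (\<lambda>z. Re (a * z ^ i) * Re (b * z ^ j))"
proof -
  have le: "harmonic_polynomial_on_circle R (\<lambda>z. Re (a * z ^ i) * Re (b * z ^ j))" if "j \<le> i" for a b i j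
  proof (rule harmonic_polynomial_on_circleI)
    fix z assume z: "cmod z = R"
    have Re_mult_Re: "Re x * Re y = Re (x * y) / 2 + Re (x * cnj y) / 2" for x y
      by (simp add: field_simps)
    have "z ^ i * cnj (z ^ j) = z ^ (i - j) * (z * cnj z) ^ j"
      using that by (simp add: power_mult_distrib mult.assoc[symmetric] power_add[symmetric])
    then have pw: "z ^ i * cnj (z ^ j) = of_real (R ^ (2 * j)) * z ^ (i - j)"
      using z by (simp add: complex_norm_square[symmetric] power_mult)
    have "Re (a * z ^ i) * Re (b * z ^ j)
        = Re ((a * z ^ i) * (b * z ^ j)) / 2 + Re ((a * z ^ i) * cnj (b * z ^ j)) / 2"
      by (rule Re_mult_Re)
    also have "(a * z ^ i) * cnj (b * z ^ j) = a * cnj b * (z ^ i * cnj (z ^ j))" by simp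
    finally show "Re (a * z ^ i) * Re (b * z ^ j)
        = Re (poly (monom (a * b / 2) (i + j) + monom (a * cnj b * of_real (R ^ (2 * j)) / 2) (i - j)) z)"
      unfolding pw by (simp add: poly_monom power_add mult_ac)
  qed
  show ?thesis
  proof (cases "j \<le> i")
    case False
    then show ?thesis using le[of i j b a] by (simp add: mult.commute)
  qed (rule le)
qed

lemma harmonic_polynomial_on_circle_mult:
  assumes "harmonic_polynomial_on_circle R u" "harmonic_polynomial_on_circle R v"
  shows "harmonic_polynomial_on_circle R (\<lambda>z. u z * v z)"
proof -
  obtain p q where pq: "\<forall>z. cmod z = R \<longrightarrow> u z = Re (poly p z)" "\<forall>z. cmod z = R \<longrightarrow> v z = Re (poly q z)"
    using assms by (auto simp: harmonic_polynomial_on_circle_def)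
  have "harmonic_polynomial_on_circle R
      (\<lambda>z. \<Sum>i\<le>degree p. \<Sum>j\<le>degree q. Re (coeff p i * z ^ i) * Re (coeff q j * z ^ j))"
    by (intro harmonic_polynomial_on_circle_sum harmonic_polynomial_on_circle_mult_monom) auto
  then show ?thesis
    by (rule harmonic_polynomial_on_circle_cong[rotated])
       (use pq in \<open>simp add: poly_altdef Re_sum sum_product\<close>)
qed

text \<open>By Stone-Weierstrass, the Dirichlet problem on the disc is solved approximately by real
  parts of polynomials, which takes the place of a Poisson integral. Re and Im separate the points
  of the circle.\<close>

lemma harmonic_polynomial_on_circle_dense:
  assumes cont: "continuous_on (sphere 0 R) u" and e: "e > 0"
  obtains p where "\<And>z. cmod z = R \<Longrightarrow> \<bar>u z - Re (poly p z)\<bar> < e"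
proof -
  have "\<exists>g. harmonic_polynomial_on_circle R g \<and> (\<forall>x\<in>sphere 0 R. \<bar>u x - g x\<bar> < e)"
  proof (rule Stone_Weierstrass_HOL)
    show "harmonic_polynomial_on_circle R (\<lambda>x. c)" for c
      by (rule harmonic_polynomial_on_circleI[of _ _ "[:of_real c:]"]) simp
    show "continuous_on (sphere 0 R) g" if g: "harmonic_polynomial_on_circle R g" for g
    proof -
      obtain p where "\<forall>z. cmod z = R \<longrightarrow> g z = Re (poly p z)"
        using g by (auto simp: harmonic_polynomial_on_circle_def)
      then show ?thesis
        by (subst continuous_on_cong[OF refl, of _ _ "\<lambda>z. Re (poly p z)"]) (auto intro!: continuous_intros)
    qed
    show "\<exists>g. harmonic_polynomial_on_circle R g \<and> g x \<noteq> g y" if "x \<in> sphere 0 R \<and> y \<in> sphere 0 R \<and> x \<noteq> y" for x y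
    proof (cases "Re x = Re y")
      case True
      then have "Im x \<noteq> Im y" using that complex_eqI by blast
      moreover have "harmonic_polynomial_on_circle R Im"
        by (rule harmonic_polynomial_on_circleI[of _ _ "[:0, - \<i>:]"]) simp
      ultimately show ?thesis by blast
    next
      case False
      moreover have "harmonic_polynomial_on_circle R Re"
        by (rule harmonic_polynomial_on_circleI[of _ _ "[:0, 1:]"]) simp
      ultimately show ?thesis by blast
    qed
  qed (use cont e in \<open>auto intro: harmonic_polynomial_on_circle_add harmonic_polynomial_on_circle_mult\<close>)
  then obtain g where g: "harmonic_polynomial_on_circle R g" "\<And>x. cmod x = R \<Longrightarrow> \<bar>u x - g x\<bar> < e" by auto
  from g(1) have "\<exists>p. \<forall>z. cmod z = R \<longrightarrow> g z = Re (poly p z)"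
    by (simp add: harmonic_polynomial_on_circle_def)
  then obtain p where "\<forall>z. cmod z = R \<longrightarrow> g z = Re (poly p z)" ..
  then show ?thesis using that[of p] g(2) by simp
qed

lemma mean_value_circle:
  assumes "p holomorphic_on UNIV" and R: "R > 0"
  shows "((\<lambda>\<theta>. Re (p (of_real R * cis \<theta>))) has_integral 2 * pi * Re (p 0)) {0..2 * pi}"
proof -
  have "((\<lambda>u. p u / (u - 0)) has_contour_integral (2 * of_real pi * \<i> * p 0)) (circlepath 0 R)"
    by (rule Cauchy_integral_circlepath_simple) (use assms holomorphic_on_subset in auto)
  then have "((\<lambda>t. p (of_real R * cis t) / (of_real R * cis t) * of_real R * \<i> * cis t)
      has_integral (2 * of_real pi * \<i> * p 0)) {0..2 * pi}"
    unfolding circlepath_def by (subst (asm) has_contour_integral_part_circlepath_iff) auto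
  moreover have "(\<lambda>t. p (of_real R * cis t) / (of_real R * cis t) * of_real R * \<i> * cis t)
      = (\<lambda>t. \<i> * p (of_real R * cis t))"
    using R by (auto simp: field_simps)
  ultimately have "((\<lambda>t. \<i> * p (of_real R * cis t)) has_integral (2 * of_real pi * \<i> * p 0)) {0..2 * pi}" by simp
  from has_integral_Im[OF this] show ?thesis by simp
qed

lemma continuous_on_log_plus_cmod:
  assumes "f holomorphic_on UNIV"
  shows "continuous_on S (\<lambda>z. log_plus (cmod (f z)))"
  unfolding log_plus_def
proof (intro continuous_intros)
  show "continuous_on S f"
    using assms by (meson holomorphic_on_imp_continuous_on holomorphic_on_subset subset_UNIV)
qed (smt (verit) max.cobounded1)

text \<open>A harmonic polynomial slightly above \<open>log_plus \<bar>f\<bar>\<close> on the circle of radius \<open>R\<close> dominates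
  \<open>log_plus \<bar>f\<bar>\<close> inside, and its value at the centre is its mean.\<close>

lemma log_plus_le_proximity:
  assumes hol: "f holomorphic_on UNIV" and z: "cmod z \<le> r" and r: "r < R"
  shows "(R - r) * log_plus (cmod (f z)) \<le> (R + r) * proximity f R"
proof -
  have R: "R > 0" "r \<ge> 0" using z r norm_ge_zero[of z] by linarith+
  have approx: "(R - r) * log_plus (cmod (f z)) \<le> (R + r) * (proximity f R + 2 * e)" if e: "e > 0" for e
  proof -
    \<comment> \<open>Raising the boundary function by \<open>e\<close> before approximating within
      \<open>e\<close> makes the approximant an upper bound that exceeds it by at most
      \<open>2 * e\<close>.\<close>
    have "continuous_on (sphere 0 R) (\<lambda>z. log_plus (cmod (f z)) + e)"
      by (intro continuous_intros continuous_on_log_plus_cmod hol)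
    from harmonic_polynomial_on_circle_dense[OF this e]
    obtain q where q: "\<And>z. cmod z = R \<Longrightarrow> \<bar>log_plus (cmod (f z)) + e - Re (poly q z)\<bar> < e" by blast
    define p where "p = poly q"
    have q1: "log_plus (cmod (f z)) \<le> Re (p z)" "Re (p z) \<le> log_plus (cmod (f z)) + 2 * e"
      if "cmod z = R" for z using q[OF that] by (auto simp: p_def)
    have hp: "p holomorphic_on S" for S unfolding p_def by (intro holomorphic_intros)
    have fr: "cmod u = R" if "u \<in> frontier (cball 0 R)" for u :: complex
      using that R by (simp add: frontier_cball)
    \<comment> \<open>The maximum principle for the holomorphic function f exp (- p) replaces
      subharmonicity of ln |f|.\<close>
    have f_le: "ln (cmod (f w)) \<le> Re (p w)" if w: "w \<in> cball 0 R" "f w \<noteq> 0" for w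
    proof -
      have "cmod (f w * exp (- p w)) \<le> 1"
      proof (rule maximum_modulus_frontier[where f = "\<lambda>w. f w * exp (- p w)" and S = "cball 0 R"])
        have h: "(\<lambda>w. f w * exp (- p w)) holomorphic_on UNIV" by (intro holomorphic_intros hol hp)
        show "(\<lambda>w. f w * exp (- p w)) holomorphic_on interior (cball 0 R)" using h holomorphic_on_subset by blast
        show "continuous_on (closure (cball 0 R)) (\<lambda>w. f w * exp (- p w))"
          using h holomorphic_on_imp_continuous_on holomorphic_on_subset by blast
        fix u :: complex assume "u \<in> frontier (cball 0 R)"
        then have "log_plus (cmod (f u)) \<le> Re (p u)" using q1 fr by blast
        then have "cmod (f u) \<le> exp (Re (p u))"
          using le_exp_log_plus[of "cmod (f u)"] by (smt (verit) exp_le_cancel_iff)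
        then show "cmod (f u * exp (- p u)) \<le> 1" by (simp add: norm_mult norm_divide exp_minus field_simps)
      qed (use w in auto)
      then have "cmod (f w) \<le> exp (Re (p w))" by (simp add: norm_mult norm_divide exp_minus field_simps)
      then have "ln (cmod (f w)) \<le> ln (exp (Re (p w)))" using w(2) by (subst ln_le_cancel_iff) auto
      then show ?thesis by simp
    qed
    \<comment> \<open>Positivity inside settles the points with |f| \<le> 1 and is the hypothesis of
      Harnack's inequality.\<close>
    have p_nonneg: "Re (p w) \<ge> 0" if w: "w \<in> cball 0 R" for w
    proof -
      have "Re (- p w) \<le> 0"
      proof (rule maximum_real_frontier[where f = "\<lambda>w. - p w" and S = "cball 0 R"])
        show "(\<lambda>w. - p w) holomorphic_on interior (cball 0 R)" by (intro holomorphic_intros hp)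
        show "continuous_on (closure (cball 0 R)) (\<lambda>w. - p w)" by (intro continuous_intros holomorphic_on_imp_continuous_on hp)
        fix u :: complex assume "u \<in> frontier (cball 0 R)"
        then show "Re (- p u) \<le> 0" using q1(1)[of u] fr[of u] order_trans[OF log_plus_nonneg] by auto
      qed (use w in auto)
      then show ?thesis by simp
    qed
    have zR: "z \<in> cball 0 R" "z \<in> ball 0 R" using z r by auto
    have "log_plus (cmod (f z)) \<le> Re (p z)"
    proof (cases "cmod (f z) \<le> 1")
      case True
      then show ?thesis using p_nonneg zR by (simp add: log_plus_def)
    next
      case False
      then have "f z \<noteq> 0" by auto
      then show ?thesis using False f_le zR by (simp add: log_plus_def)
    qed
    then have "(R - r) * log_plus (cmod (f z)) \<le> (R - r) * Re (p z)" using r by (intro mult_left_mono) auto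
    also have "\<dots> \<le> (R - dist 0 z) * Re (p z)" using z zR p_nonneg by (intro mult_right_mono) auto
    also have "\<dots> \<le> (R + dist 0 z) * Re (p 0)"
      by (rule harnack(2)[OF hp]) (use zR p_nonneg in auto)
    also have "\<dots> \<le> (R + r) * Re (p 0)" using z R p_nonneg[of 0] by (intro mult_right_mono) auto
    also have "\<dots> \<le> (R + r) * (proximity f R + 2 * e)"
    proof (rule mult_left_mono)
      have "continuous_on {0..2 * pi} ((\<lambda>z. log_plus (cmod (f z))) \<circ> (\<lambda>\<theta>. of_real R * cis \<theta>))"
        by (intro continuous_on_compose continuous_intros continuous_on_log_plus_cmod hol)
      then have int: "(\<lambda>\<theta>. log_plus (cmod (f (of_real R * cis \<theta>)))) integrable_on {0..2 * pi}"
        by (intro integrable_continuous_interval) (simp add: o_def)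
      have "((\<lambda>\<theta>. log_plus (cmod (f (of_real R * cis \<theta>))) + 2 * e) has_integral
          (integral {0..2 * pi} (\<lambda>\<theta>. log_plus (cmod (f (of_real R * cis \<theta>)))) + (2 * pi - 0) *\<^sub>R (2 * e))) {0..2 * pi}"
        using has_integral_const_real[of "2 * e" 0 "2 * pi"]
        by (intro has_integral_add integrable_integral int) simp
      from has_integral_le[OF mean_value_circle[OF hp R(1)] this]
      have "2 * pi * Re (p 0) \<le> integral {0..2 * pi} (\<lambda>\<theta>. log_plus (cmod (f (of_real R * cis \<theta>)))) + 2 * pi * (2 * e)"
        using q1(2) R by (simp add: norm_mult)
      then show "Re (p 0) \<le> proximity f R + 2 * e"
        unfolding proximity_def by (simp add: field_simps)
    qed (use R in simp)
    finally show ?thesis .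
  qed
  show ?thesis
  proof (rule field_le_epsilon)
    fix d :: real assume "d > 0"
    then have "(R - r) * log_plus (cmod (f z)) \<le> (R + r) * (proximity f R + 2 * (d / (2 * (R + r))))"
      using R by (intro approx) auto
    also have "\<dots> = (R + r) * proximity f R + d"
    proof -
      have "S * (proximity f R + 2 * (d / (2 * S))) = S * proximity f R + d" if "S > 0" for S
        using that by (simp add: field_simps)
      from this[of "R + r"] show ?thesis using R by linarith
    qed
    finally show "(R - r) * log_plus (cmod (f z)) \<le> (R + r) * proximity f R + d" .
  qed
qed

lemma nevanlinna_characteristic_entire:
  assumes "f holomorphic_on UNIV"
  shows "nevanlinna_characteristic f r = proximity f r"
proof -
  have "\<not> is_pole f z" for z
    using assms by (meson UNIV_I open_UNIV not_is_pole_holomorphic)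
  then show ?thesis
    by (simp add: nevanlinna_characteristic_def integrated_pole_count_def pole_count_def)
qed

section \<open>Subnormal solutions have exponential type\<close>

text \<open>Multiply \<open>f\<close> by exp (- \<open>\<epsilon>\<close> E), apply the maximum
  principle on a rectangle long enough that this factor beats the growth of \<open>f\<close> on its
  right edge, and let \<open>\<epsilon>\<close> tend to 0.\<close>

lemma phragmen_lindelof_half_strip:
  assumes hol: "f holomorphic_on UNIV"
    and growth: "\<And>z. cmod (f z) \<le> exp (X * exp (cmod z / 2))" and X: "X \<ge> 0" and B: "B \<ge> 1"
    and bottom: "\<And>z. Re z = 0 \<Longrightarrow> \<bar>Im z - a\<bar> \<le> pi / 2 \<Longrightarrow> cmod (f z) \<le> B"
    and sides: "\<And>z. Re z \<ge> 0 \<Longrightarrow> \<bar>Im z - a\<bar> = pi / 2 \<Longrightarrow> cmod (f z) \<le> B"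
    and z: "Re z \<ge> 0" "\<bar>Im z - a\<bar> \<le> pi / 2"
  shows "cmod (f z) \<le> B"
proof -
  \<comment> \<open>The rate 3/4 lies between the growth rate 1/2 of the hypothesis and the critical
    rate 1 of a strip of width pi; being below 1, it keeps Re E at least \<open>\<kappa>\<close> exp
    (3 Re w / 4) up to the sides.\<close>
  define E where "E w = exp (of_real (3 / 4) * (w - \<i> * of_real a))" for w
  define \<kappa> where "\<kappa> = cos (3 * pi / 8)"
  have \<kappa>: "\<kappa> > 0" unfolding \<kappa>_def by (intro cos_gt_zero) auto
  have ReE: "Re (E w) = exp (3 / 4 * Re w) * cos (3 / 4 * (Im w - a))" for w
    by (simp add: E_def Re_exp)
  have ReE_ge: "Re (E w) \<ge> exp (3 / 4 * Re w) * \<kappa>" if "\<bar>Im w - a\<bar> \<le> pi / 2" for w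
  proof -
    have "cos (3 * pi / 8) \<le> cos \<bar>3 / 4 * (Im w - a)\<bar>"
    proof (rule cos_monotone_0_pi_le)
      have "\<bar>3 / 4 * (Im w - a)\<bar> = 3 / 4 * \<bar>Im w - a\<bar>" by (simp add: abs_mult del: right_diff_distrib_numeral)
      also have "\<dots> \<le> 3 / 4 * (pi / 2)" using that by (rule mult_left_mono) simp
      finally show "\<bar>3 / 4 * (Im w - a)\<bar> \<le> 3 * pi / 8" by simp
    qed auto
    then have "\<kappa> \<le> cos (3 / 4 * (Im w - a))" by (simp only: \<kappa>_def cos_abs_real)
    then show ?thesis unfolding ReE by (intro mult_left_mono) auto
  qed
  have bound: "cmod (f z) \<le> B * exp (\<epsilon> * Re (E z))" if \<epsilon>: "\<epsilon> > 0" for \<epsilon>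
  proof -
    \<comment> \<open>On the edge Re w = T the growth exponent is at most
      \<open>\<epsilon> * \<kappa> * Q * exp (T / 2)\<close>, so \<open>Q \<le> exp (T / 4)\<close>
      is what makes it no larger than \<open>\<epsilon>\<close> Re E.\<close>
    define Q where "Q = X * exp ((\<bar>a\<bar> + pi / 2) / 2) / (\<epsilon> * \<kappa>)"
    define T where "T = max (Re z) (4 * ln (1 + Q))"
    have Q: "Q \<ge> 0" using X \<epsilon> \<kappa> by (simp add: Q_def)
    have T: "T \<ge> 0" "T \<ge> Re z" using z by (auto simp: T_def)
    have QT: "Q \<le> exp (T / 4)"
    proof -
      have "ln (1 + Q) \<le> T / 4" by (simp add: T_def)
      then have "exp (ln (1 + Q)) \<le> exp (T / 4)" by (simp only: exp_le_cancel_iff)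
      then show ?thesis using Q by simp
    qed
    define F where "F w = f w * exp (- of_real \<epsilon> * E w)" for w
    have nF: "cmod (F w) = cmod (f w) * exp (- \<epsilon> * Re (E w))" for w
      by (simp add: F_def norm_mult)
    have F_le: "cmod (F w) \<le> cmod (f w)" if "\<bar>Im w - a\<bar> \<le> pi / 2" for w
    proof -
      have "0 \<le> exp (3 / 4 * Re w) * \<kappa>" using \<kappa> by simp
      then have "exp (- \<epsilon> * Re (E w)) \<le> 1" using ReE_ge[OF that] \<epsilon> by simp
      then show ?thesis unfolding nF by (intro mult_left_le) auto
    qed
    define S where "S = cbox (Complex 0 (a - pi / 2)) (Complex T (a + pi / 2))"
    have S: "w \<in> S \<longleftrightarrow> 0 \<le> Re w \<and> Re w \<le> T \<and> \<bar>Im w - a\<bar> \<le> pi / 2" for w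
      unfolding S_def in_cbox_complex_iff complex.sel atLeastAtMost_iff by linarith
    have holF: "F holomorphic_on UNIV" unfolding F_def[abs_def] E_def
      by (intro holomorphic_intros hol)
    have "cmod (F z) \<le> B"
    proof (rule maximum_modulus_frontier[of F S])
      show "F holomorphic_on interior S" using holF holomorphic_on_subset by blast
      show "continuous_on (closure S) F" using holF holomorphic_on_imp_continuous_on holomorphic_on_subset by blast
      show "bounded S" by (simp add: S_def)
      show "z \<in> S" using S z T by simp
      fix w assume w: "w \<in> frontier S"
      have "frontier S = S - box (Complex 0 (a - pi / 2)) (Complex T (a + pi / 2))"
        by (simp add: S_def frontier_cbox)
      with w have "w \<in> S" and "w \<notin> box (Complex 0 (a - pi / 2)) (Complex T (a + pi / 2))" by auto
      then have wS: "0 \<le> Re w" "Re w \<le> T" "\<bar>Im w - a\<bar> \<le> pi / 2"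
        and nb: "\<not> (0 < Re w \<and> Re w < T \<and> a - pi / 2 < Im w \<and> Im w < a + pi / 2)"
        by (simp_all add: S in_box_complex_iff)
      have w': "Re w = 0 \<or> Re w = T \<or> \<bar>Im w - a\<bar> = pi / 2" using wS nb by linarith
      consider "Re w = 0" | "\<bar>Im w - a\<bar> = pi / 2" | "Re w = T" using w' by blast
      then show "cmod (F w) \<le> B"
      proof cases
        case 1
        then show ?thesis using bottom[OF 1 wS(3)] F_le[OF wS(3)] by linarith
      next
        case 2
        then show ?thesis using sides[OF wS(1) 2] F_le[OF wS(3)] by linarith
      next
        case 3
        have "cmod w \<le> \<bar>Re w\<bar> + \<bar>Im w\<bar>" by (rule cmod_le)
        also have "\<dots> \<le> T + (\<bar>a\<bar> + pi / 2)" using 3 T wS by linarith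
        finally have "X * exp (cmod w / 2) \<le> X * (exp (T / 2) * exp ((\<bar>a\<bar> + pi / 2) / 2))"
          using X by (intro mult_left_mono) (simp_all add: exp_add[symmetric] add_divide_distrib)
        also have "\<dots> = \<epsilon> * \<kappa> * (Q * exp (T / 2))" using \<epsilon> \<kappa> by (simp add: Q_def)
        also have "\<dots> \<le> \<epsilon> * \<kappa> * (exp (T / 4) * exp (T / 2))"
          using \<epsilon> \<kappa> QT by (intro mult_left_mono mult_right_mono) auto
        also have "\<dots> = \<epsilon> * (exp (3 / 4 * Re w) * \<kappa>)" using 3 by (simp add: exp_add[symmetric])
        also have "\<dots> \<le> \<epsilon> * Re (E w)" using ReE_ge[OF wS(3)] \<epsilon> by (intro mult_left_mono) auto
        finally have le: "X * exp (cmod w / 2) \<le> \<epsilon> * Re (E w)" .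
        have "cmod (F w) \<le> exp (X * exp (cmod w / 2)) * exp (- \<epsilon> * Re (E w))"
          unfolding nF by (intro mult_right_mono growth) auto
        also have "\<dots> \<le> 1" using le by (simp add: exp_add[symmetric])
        finally show ?thesis using B by simp
      qed
    qed
    then have "cmod (f z) * exp (- \<epsilon> * Re (E z)) * exp (\<epsilon> * Re (E z)) \<le> B * exp (\<epsilon> * Re (E z))"
      unfolding nF by (intro mult_right_mono) auto
    then show ?thesis by (simp add: mult.assoc exp_add[symmetric])
  qed
  have "((\<lambda>\<epsilon>. B * exp (\<epsilon> * Re (E z))) \<longlongrightarrow> B * exp (0 * Re (E z))) (at_right 0)"
    by (intro tendsto_intros)
  moreover have "\<forall>\<^sub>F \<epsilon> in at_right 0. cmod (f z) \<le> B * exp (\<epsilon> * Re (E z))"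
    using bound by (auto simp: eventually_at_filter)
  ultimately show ?thesis by (intro tendsto_lowerbound[of "\<lambda>\<epsilon>. B * exp (\<epsilon> * Re (E z))" B "at_right 0"]) auto
qed

context exponential_ode
begin

text \<open>The segment from 0 to \<open>z\<close> stays in the left half-plane, where |exp (2 w)|
  \<le> 1. The derivative is kept because it is initial data on the imaginary axis for
  \<open>horizontal_line_energy\<close>.\<close>

lemma left_half_plane_bound:
  obtains V Y where "V \<ge> 1" "Y \<ge> 0"
    "\<And>z. Re z \<le> 0 \<Longrightarrow> (cmod (f z))\<^sup>2 + (cmod (deriv f z))\<^sup>2 \<le> V * exp (Y * cmod z)"
proof -
  define V where "V = (cmod \<sigma>)\<^sup>2 + (cmod (f 0))\<^sup>2 + (cmod (deriv f 0))\<^sup>2"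
  define Y where "Y = 2 * cmod (\<mu> + 1) + 1 + (cmod \<nu>)\<^sup>2 + 2"
  have "(cmod (f z))\<^sup>2 + (cmod (deriv f z))\<^sup>2 \<le> (V + 1) * exp (Y * cmod z)" if z: "Re z \<le> 0" for z
  proof -
    have "exp (2 * Re w) \<le> 1" if "w \<in> closed_segment 0 z" for w
    proof -
      obtain u where "0 \<le> u" "w = u *\<^sub>R z" using \<open>w \<in> closed_segment 0 z\<close> by (auto simp: in_segment)
      then show ?thesis using z by (simp add: mult_nonneg_nonpos)
    qed
    then have "(cmod (f z))\<^sup>2 + (cmod (deriv f z))\<^sup>2 \<le> V * exp (Y * cmod z)"
      using gronwall_from_zero[of 1 z] unfolding V_def Y_def by simp
    then show ?thesis by (simp add: distrib_right add_increasing2)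
  qed
  moreover have "V + 1 \<ge> 1" "Y \<ge> 0" by (simp_all add: V_def Y_def)
  ultimately show ?thesis using that by blast
qed

text \<open>On the lines \<open>Im z = k \<pi>\<close> the coefficient \<open>e\<^sup>2\<^sup>z\<close> is positive, so \<open>|f'|\<^sup>2 + e\<^sup>2\<^sup>s |f|\<^sup>2\<close> is an energy
  that grows at most exponentially in \<open>s\<close>.\<close>

lemma horizontal_line_energy:
  fixes k :: int
  assumes s: "s \<ge> 0" and z: "z = Complex s (of_int k * pi)" and z0: "z0 = Complex 0 (of_int k * pi)"
  shows "(cmod (f z))\<^sup>2 \<le> ((cmod (f z0))\<^sup>2 + (cmod (deriv f z0))\<^sup>2 + (cmod \<sigma> * exp (cmod (\<mu> + 1) * (s + \<bar>of_int k\<bar> * pi)))\<^sup>2)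
     * exp (((cmod \<nu>)\<^sup>2 + 3) * s)"
proof -
  have hd: "deriv f holomorphic_on UNIV" using hol by (simp add: holomorphic_deriv)
  define S where "S = cmod \<sigma> * exp (cmod (\<mu> + 1) * (s + \<bar>of_int k\<bar> * pi))"
  define p where "p t = z0 + of_real t * 1" for t
  have ep: "exp (2 * p t) = of_real (exp (2 * t))" for t
  proof -
    have "exp (2 * p t) = exp (2 * of_real t + 2 * of_int k * pi * \<i>)"
      by (intro arg_cong[of _ _ exp]) (simp add: p_def z0 complex_eq_iff)
    also have "\<dots> = exp (2 * of_real t)"
      using exp_integer_2pi[of "of_int k"] by (simp add: exp_add mult_ac)
    finally show ?thesis by (simp add: exp_of_real[symmetric])
  qed
  define v where "v t = (cmod (deriv f (p t)))\<^sup>2 + exp (2 * t) * (cmod (f (p t)))\<^sup>2 + S\<^sup>2" for t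
  define v' where "v' t = 2 * (deriv f (p t) \<bullet> (1 * deriv (deriv f) (p t)))
      + (exp (2 * t) * 2 * (cmod (f (p t)))\<^sup>2 + (2 * (f (p t) \<bullet> (1 * deriv f (p t)))) * exp (2 * t))" for t
  have "v s \<le> v 0 * exp (((cmod \<nu>)\<^sup>2 + 3) * s)"
  proof (rule gronwall[OF s])
    fix t :: real
    have "((\<lambda>t. exp (2 * t)) has_real_derivative exp (2 * t) * 2) (at t)"
      by (auto intro!: derivative_eq_intros)
    from DERIV_add[OF DERIV_add[OF has_real_derivative_norm_square[OF entire_line_derivative[OF hd, of z0 1]]
         DERIV_mult[OF this has_real_derivative_norm_square[OF entire_line_derivative[OF hol, of z0 1]]]] DERIV_const[of "S\<^sup>2"]]
    show "(v has_real_derivative v' t) (at t)"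
      unfolding v_def v'_def p_def by simp
    assume t: "0 \<le> t" "t \<le> s"
    let ?x = "f (p t)" and ?y = "deriv f (p t)"
    define g where "g = \<sigma> * exp ((\<mu> + 1) * p t)"
    have g: "cmod g \<le> S"
    proof -
      have "cmod (p t) \<le> \<bar>Re (p t)\<bar> + \<bar>Im (p t)\<bar>" by (rule cmod_le)
      also have "\<dots> \<le> s + \<bar>of_int k\<bar> * pi" using t by (simp add: p_def z0 abs_mult)
      finally have "cmod (\<mu> + 1) * cmod (p t) \<le> cmod (\<mu> + 1) * (s + \<bar>of_int k\<bar> * pi)" by (intro mult_left_mono) auto
      moreover have "Re ((\<mu> + 1) * p t) \<le> cmod (\<mu> + 1) * cmod (p t)"
        using complex_Re_le_cmod[of "(\<mu> + 1) * p t"] by (simp only: norm_mult)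
      ultimately show ?thesis unfolding g_def S_def norm_mult norm_exp_eq_Re by (intro mult_left_mono) auto
    qed
    have d2: "deriv (deriv f) (p t) = \<nu>\<^sup>2 * ?x + g - exp (2 * t) *\<^sub>R ?x"
      using ode[of "p t"] unfolding ep g_def scaleR_conv_of_real by (simp add: algebra_simps)
    \<comment> \<open>The two cross terms with exp (2 t) times the inner product of f and f' cancel,
      because the coefficient is real on this line. Only the derivative of the weight survives, and
      the energy controls it.\<close>
    have "v' t = 2 * (?y \<bullet> (\<nu>\<^sup>2 * ?x)) + 2 * (?y \<bullet> g) + 2 * (exp (2 * t) * (cmod ?x)\<^sup>2)"
      unfolding v'_def d2 by (simp add: inner_diff_right inner_add_right inner_commute algebra_simps)
    also have "?y \<bullet> (\<nu>\<^sup>2 * ?x) \<le> cmod ?y * ((cmod \<nu>)\<^sup>2 * cmod ?x)"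
      using norm_cauchy_schwarz[of ?y "\<nu>\<^sup>2 * ?x"] by (simp add: norm_mult norm_power)
    also have "?y \<bullet> g \<le> cmod ?y * S"
      using norm_cauchy_schwarz[of ?y g] mult_left_mono[OF g, of "cmod ?y"] by simp
    finally have "v' t \<le> (cmod \<nu>)\<^sup>2 * (2 * (cmod ?y * cmod ?x)) + 2 * (cmod ?y * S) + 2 * (exp (2 * t) * (cmod ?x)\<^sup>2)"
      by (simp add: mult_ac)
    also have "\<dots> \<le> (cmod \<nu>)\<^sup>2 * v t + ((cmod ?y)\<^sup>2 + S\<^sup>2) + 2 * (exp (2 * t) * (cmod ?x)\<^sup>2)"
    proof -
      have "1 * (cmod ?x)\<^sup>2 \<le> exp (2 * t) * (cmod ?x)\<^sup>2" using t by (intro mult_right_mono) auto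
      then have "2 * (cmod ?y * cmod ?x) \<le> v t"
        using sum_squares_bound[of "cmod ?y" "cmod ?x"] zero_le_power2[of S] unfolding v_def by linarith
      then have "(cmod \<nu>)\<^sup>2 * (2 * (cmod ?y * cmod ?x)) \<le> (cmod \<nu>)\<^sup>2 * v t" by (intro mult_left_mono) auto
      then show ?thesis using sum_squares_bound[of "cmod ?y" S] by linarith
    qed
    also have "\<dots> \<le> (cmod \<nu>)\<^sup>2 * v t + 3 * v t"
    proof -
      have "0 \<le> exp (2 * t) * (cmod ?x)\<^sup>2" by simp
      then have "((cmod ?y)\<^sup>2 + S\<^sup>2) + 2 * (exp (2 * t) * (cmod ?x)\<^sup>2) \<le> 3 * v t"
        using zero_le_power2[of S] zero_le_power2[of "cmod ?y"] unfolding v_def distrib_left by linarith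
      then show ?thesis by simp
    qed
    finally show "v' t \<le> ((cmod \<nu>)\<^sup>2 + 3) * v t" by (simp add: distrib_right)
  qed
  moreover have "(cmod (f z))\<^sup>2 \<le> v s"
  proof -
    have "p s = z" by (simp add: p_def z z0 complex_eq_iff)
    moreover have "1 * (cmod (f z))\<^sup>2 \<le> exp (2 * s) * (cmod (f z))\<^sup>2" using s by (intro mult_right_mono) auto
    ultimately show ?thesis by (simp add: v_def add_increasing add_increasing2)
  qed
  moreover have "v 0 = (cmod (f z0))\<^sup>2 + (cmod (deriv f z0))\<^sup>2 + S\<^sup>2" by (simp add: v_def p_def)
  ultimately show ?thesis by (simp add: S_def)
qed

end

context exponential_ode
begin

text \<open>The constants must be independent of the line, as all strips are used at once. The
  dependence on \<open>k\<close> enters only through the modulus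
  \<open>\<bar>of_int k\<bar> * pi\<close> of the starting point on the imaginary axis.\<close>

lemma boundary_bounds:
  obtains W Z where "W \<ge> 1" "Z \<ge> 0"
    "\<And>z. Re z \<le> 0 \<Longrightarrow> cmod (f z) \<le> W * exp (Z * cmod z)"
    "\<And>s k. s \<ge> 0 \<Longrightarrow> cmod (f (Complex s (of_int k * pi))) \<le> W * exp (Z * (s + \<bar>of_int k\<bar> * pi))"
proof -
  obtain V Y where VY: "V \<ge> 1" "Y \<ge> 0"
    "\<And>z. Re z \<le> 0 \<Longrightarrow> (cmod (f z))\<^sup>2 + (cmod (deriv f z))\<^sup>2 \<le> V * exp (Y * cmod z)"
    using left_half_plane_bound by blast
  define W where "W = V + (cmod \<sigma>)\<^sup>2"
  define Z where "Z = Y + 2 * cmod (\<mu> + 1) + (cmod \<nu>)\<^sup>2 + 3"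
  have W: "W \<ge> 1" using VY by (simp add: W_def add_increasing2)
  have Z: "Z \<ge> Y" "Z \<ge> 0" using VY(2) by (simp_all add: Z_def)
  \<comment> \<open>The estimates concern squares; a bound that is at least 1 is at most its own
    square, so the same constants serve for the modulus.\<close>
  have root: "cmod x \<le> W * exp (Z * t)" if le: "(cmod x)\<^sup>2 \<le> W * exp (Z * t)" and t: "t \<ge> 0" for x :: complex and t
  proof (rule power2_le_imp_le)
    have "1 * 1 \<le> W * exp (Z * t)" using W Z t by (intro mult_mono) auto
    then have "W * exp (Z * t) \<le> (W * exp (Z * t))\<^sup>2" by (intro self_le_power) auto
    with le show "(cmod x)\<^sup>2 \<le> (W * exp (Z * t))\<^sup>2" by (rule order_trans)
    show "0 \<le> W * exp (Z * t)" using W by simp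
  qed
  have left: "cmod (f z) \<le> W * exp (Z * cmod z)" if "Re z \<le> 0" for z
  proof (rule root)
    have "(cmod (f z))\<^sup>2 \<le> V * exp (Y * cmod z)"
      using VY(3)[OF that] zero_le_power2[of "cmod (deriv f z)"] by linarith
    also have "\<dots> \<le> W * exp (Z * cmod z)"
      using VY Z W by (intro mult_mono) (auto simp: W_def intro: mult_right_mono)
    finally show "(cmod (f z))\<^sup>2 \<le> W * exp (Z * cmod z)" .
  qed simp
  have lines: "cmod (f (Complex s (of_int k * pi))) \<le> W * exp (Z * (s + \<bar>of_int k\<bar> * pi))" if s: "s \<ge> 0" for s and k :: int
  proof (rule root)
    define t where "t = s + \<bar>of_int k\<bar> * pi"
    have t: "t \<ge> 0" "s \<le> t" "\<bar>of_int k\<bar> * pi \<le> t" using s by (auto simp: t_def)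
    define z0 where "z0 = Complex 0 (of_int k * pi)"
    have "cmod z0 = \<bar>of_int k\<bar> * pi" by (simp add: z0_def cmod_def abs_mult)
    moreover have "(cmod (f z0))\<^sup>2 + (cmod (deriv f z0))\<^sup>2 \<le> V * exp (Y * cmod z0)"
      by (rule VY(3)) (simp add: z0_def)
    moreover have "V * exp (Y * (\<bar>of_int k\<bar> * pi)) \<le> V * exp (Y * t)"
      using VY t by (intro mult_left_mono) (auto intro: mult_left_mono)
    ultimately have "(cmod (f z0))\<^sup>2 + (cmod (deriv f z0))\<^sup>2 \<le> V * exp (Y * t)" by simp
    also have "\<dots> \<le> V * exp ((Y + 2 * cmod (\<mu> + 1)) * t)"
      using VY t by (intro mult_left_mono) (auto intro: mult_right_mono)
    finally have 1: "(cmod (f z0))\<^sup>2 + (cmod (deriv f z0))\<^sup>2 \<le> V * exp ((Y + 2 * cmod (\<mu> + 1)) * t)" .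
    have "(cmod \<sigma> * exp (cmod (\<mu> + 1) * t))\<^sup>2 = (cmod \<sigma>)\<^sup>2 * exp (2 * cmod (\<mu> + 1) * t)"
      unfolding power_mult_distrib by (simp add: exp_double[symmetric] mult.assoc)
    also have "\<dots> \<le> (cmod \<sigma>)\<^sup>2 * exp ((Y + 2 * cmod (\<mu> + 1)) * t)"
      using VY t by (intro mult_left_mono) (auto intro: mult_right_mono)
    finally have 2: "(cmod (f z0))\<^sup>2 + (cmod (deriv f z0))\<^sup>2 + (cmod \<sigma> * exp (cmod (\<mu> + 1) * t))\<^sup>2
        \<le> W * exp ((Y + 2 * cmod (\<mu> + 1)) * t)"
      using 1 unfolding W_def distrib_right by linarith
    have "(cmod (f (Complex s (of_int k * pi))))\<^sup>2
        \<le> ((cmod (f z0))\<^sup>2 + (cmod (deriv f z0))\<^sup>2 + (cmod \<sigma> * exp (cmod (\<mu> + 1) * t))\<^sup>2) * exp (((cmod \<nu>)\<^sup>2 + 3) * s)"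
      unfolding t_def by (rule horizontal_line_energy[OF s refl z0_def])
    also have "\<dots> \<le> (W * exp ((Y + 2 * cmod (\<mu> + 1)) * t)) * exp (((cmod \<nu>)\<^sup>2 + 3) * t)"
      using 2 t W by (intro mult_mono) (auto intro: mult_left_mono)
    also have "\<dots> = W * exp (Z * t)"
      by (simp add: Z_def mult.assoc exp_add[symmetric] algebra_simps)
    finally show "(cmod (f (Complex s (of_int k * pi))))\<^sup>2 \<le> W * exp (Z * (s + \<bar>of_int k\<bar> * pi))"
      by (simp add: t_def)
  qed (use s in simp)
  show ?thesis by (rule that[OF W Z(2) left lines])
qed

text \<open>In the strip containing \<open>z\<close>, the factor exp (- Z w) turns the exponential
  bounds on the horizontal sides into the constant \<open>B\<close>, which Phragmen-Lindelof then
  propagates to \<open>z\<close>.\<close>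

lemma exponential_type:
  assumes growth: "\<And>z. cmod (f z) \<le> exp (X * exp (cmod z / 2))" and X: "X \<ge> 0"
  obtains W Z where "W \<ge> 1" "Z \<ge> 0" "\<And>z. cmod (f z) \<le> W * exp (Z * cmod z)"
proof -
  obtain W Z where W: "W \<ge> 1" "Z \<ge> 0"
    and left: "\<And>z. Re z \<le> 0 \<Longrightarrow> cmod (f z) \<le> W * exp (Z * cmod z)"
    and lines: "\<And>s k. s \<ge> 0 \<Longrightarrow> cmod (f (Complex s (of_int k * pi))) \<le> W * exp (Z * (s + \<bar>of_int k\<bar> * pi))"
    using boundary_bounds by blast
  have "cmod (f z) \<le> (W * exp (Z * (2 * pi))) * exp (2 * Z * cmod z)" for z
  proof (cases "Re z \<le> 0")
    case True
    have "cmod (f z) \<le> W * exp (Z * cmod z)" by (rule left[OF True])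
    also have "\<dots> \<le> W * exp (Z * (2 * pi) + 2 * Z * cmod z)"
      using W by (intro mult_left_mono) (auto simp: algebra_simps)
    finally show ?thesis by (simp add: exp_add mult.assoc)
  next
    case False
    define k where "k = \<lfloor>Im z / pi\<rfloor>"
    \<comment> \<open>\<open>K\<close> bounds |Im w| throughout the strip and is at most |Im z| + 2
      pi, hence the constants \<open>2 * pi\<close> and \<open>2 * Z\<close> in the claim.\<close>
    define K where "K = (\<bar>of_int k\<bar> + 1) * pi"
    have k: "of_int k * pi \<le> Im z" "Im z \<le> (of_int k + 1) * pi"
    proof -
      have "of_int k \<le> Im z / pi" "Im z / pi \<le> of_int k + 1" unfolding k_def by linarith+
      then show "of_int k * pi \<le> Im z" "Im z \<le> (of_int k + 1) * pi" by (simp_all add: field_simps)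
    qed
    have absk: "\<bar>of_int k\<bar> * pi \<le> \<bar>Im z\<bar> + pi"
    proof -
      have "\<bar>of_int k * pi\<bar> \<le> \<bar>Im z\<bar> + pi" using k pi_gt_zero unfolding distrib_right by linarith
      then show ?thesis by (simp add: abs_mult)
    qed
    define a where "a = (of_int k + 1 / 2) * pi"
    define B where "B = W * exp (Z * K)"
    define F where "F w = f w * exp (- of_real Z * w)" for w
    have nF: "cmod (F w) = cmod (f w) * exp (- Z * Re w)" for w
      by (simp add: F_def norm_mult)
    have K0: "K \<ge> 0" by (simp add: K_def)
    have "cmod (F z) \<le> B"
    proof (rule phragmen_lindelof_half_strip[of F "X + 2 * Z" B a])
      show "F holomorphic_on UNIV" unfolding F_def[abs_def] by (intro holomorphic_intros hol)
      show "X + 2 * Z \<ge> 0" using X W by simp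
      have "1 * 1 \<le> W * exp (Z * K)" using W K0 by (intro mult_mono) auto
      then show "B \<ge> 1" by (simp add: B_def)
      fix w :: complex
      show "cmod (F w) \<le> exp ((X + 2 * Z) * exp (cmod w / 2))"
      proof -
        have "- Z * Re w \<le> Z * cmod w" using W(2) abs_Re_le_cmod[of w] mult_left_mono[of "- Re w" "cmod w" Z] by simp
        also have "\<dots> \<le> Z * (2 * exp (cmod w / 2))"
        proof (rule mult_left_mono[OF _ W(2)])
          show "cmod w \<le> 2 * exp (cmod w / 2)" using exp_ge_add_one_self[of "cmod w / 2"] by linarith
        qed
        finally have "cmod (F w) \<le> exp (X * exp (cmod w / 2)) * exp (2 * Z * exp (cmod w / 2))"
          unfolding nF by (intro mult_mono growth) auto
        then show ?thesis by (simp add: exp_add[symmetric] distrib_right)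
      qed
      show "cmod (F w) \<le> B" if w: "Re w = 0" "\<bar>Im w - a\<bar> \<le> pi / 2"
      proof -
        have "cmod w \<le> \<bar>Re w\<bar> + \<bar>Im w\<bar>" by (rule cmod_le)
        also have "\<dots> \<le> K"
        proof -
          have "of_int k * pi \<le> Im w" "Im w \<le> of_int k * pi + pi"
            using w(2) unfolding a_def distrib_right by linarith+
          then have "\<bar>Im w\<bar> \<le> \<bar>of_int k * pi\<bar> + pi" by linarith
          then show ?thesis using w(1) by (simp add: K_def abs_mult distrib_right)
        qed
        finally have "Z * cmod w \<le> Z * K" using W by (intro mult_left_mono) auto
        then have "W * exp (Z * cmod w) \<le> B" unfolding B_def using W by (intro mult_left_mono) auto
        then show ?thesis using left[of w] w(1) nF[of w] by simp
      qed
      show "cmod (F w) \<le> B" if w: "Re w \<ge> 0" "\<bar>Im w - a\<bar> = pi / 2"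
      proof -
        have "Im w = of_int k * pi \<or> Im w = of_int (k + 1) * pi"
          using w(2) unfolding a_def distrib_right of_int_add of_int_1 by linarith
        then obtain j :: int where j: "Im w = of_int j * pi" "\<bar>j\<bar> \<le> \<bar>k\<bar> + 1" by (smt (verit))
        have "\<bar>of_int j\<bar> * pi \<le> K" unfolding K_def using j(2) by (intro mult_right_mono pi_ge_zero) linarith
        then have "Z * (Re w + \<bar>of_int j\<bar> * pi) \<le> Z * (Re w + K)" using W by (intro mult_left_mono) auto
        then have "W * exp (Z * (Re w + \<bar>of_int j\<bar> * pi)) \<le> W * exp (Z * (Re w + K))"
          using W by (intro mult_left_mono) auto
        moreover have "cmod (f w) \<le> W * exp (Z * (Re w + \<bar>of_int j\<bar> * pi))"
          using lines[OF w(1), of j] j(1) by (metis complex.collapse)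
        ultimately have "cmod (F w) \<le> W * exp (Z * (Re w + K)) * exp (- Z * Re w)"
          unfolding nF by (intro mult_right_mono) auto
        then show ?thesis by (simp add: B_def mult.assoc exp_add[symmetric] algebra_simps)
      qed
      show "Re z \<ge> 0" using False by simp
      show "\<bar>Im z - a\<bar> \<le> pi / 2" using k unfolding a_def distrib_right by linarith
    qed
    then have "cmod (F z) * exp (Z * Re z) \<le> B * exp (Z * Re z)" by (intro mult_right_mono) auto
    then have "cmod (f z) \<le> W * exp (Z * K + Z * Re z)"
      by (simp add: nF B_def mult.assoc exp_add[symmetric])
    also have "\<dots> \<le> W * exp (Z * (2 * pi) + 2 * Z * cmod z)"
    proof -
      have "K + Re z \<le> 2 * pi + 2 * cmod z"
        using absk abs_Im_le_cmod[of z] complex_Re_le_cmod[of z] unfolding K_def distrib_right by linarith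
      then have "Z * (K + Re z) \<le> Z * (2 * pi + 2 * cmod z)" using W by (intro mult_left_mono) auto
      then show ?thesis using W by (intro mult_left_mono) (auto simp: algebra_simps)
    qed
    finally show ?thesis by (simp add: exp_add mult.assoc)
  qed
  moreover have "1 * 1 \<le> W * exp (Z * (2 * pi))" using W by (intro mult_mono) auto
  ultimately show ?thesis using that[of "W * exp (Z * (2 * pi))" "2 * Z"] W by auto
qed

lemma zero_count_linear:
  assumes W: "W \<ge> 1" "Z \<ge> 0" and type: "\<And>z. cmod (f z) \<le> W * exp (Z * cmod z)"
  obtains C r0 where "C \<ge> 0" "\<And>r. r \<ge> r0 \<Longrightarrow> real (zero_count f r) \<le> C * r"
proof -
  obtain z1 where z1: "f z1 \<noteq> 0" by (rule not_identically_zero)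
  define c where "c = ln (3 / 2 :: real)"
  have c: "c > 0" by (simp add: c_def)
  define D where "D = \<bar>ln (W / cmod (f z1))\<bar>"
  have "real (zero_count f r) \<le> ((D + 4 * Z) / c) * r" if r: "r \<ge> max (cmod z1) 1" for r
  proof -
    have "(3 / 2) ^ zero_count f r * cmod (f z1) \<le> W * exp (Z * (4 * r))"
    proof (rule zero_count_le_maximum[OF hol z1])
      show "cmod (f w) \<le> W * exp (Z * (4 * r))" if "cmod w = 4 * r" for w using type[of w] that by simp
    qed (use r in auto)
    then have "ln ((3 / 2) ^ zero_count f r * cmod (f z1)) \<le> ln (W * exp (Z * (4 * r)))"
      using W z1 by (subst ln_le_cancel_iff) auto
    then have "real (zero_count f r) * c + ln (cmod (f z1)) \<le> ln W + Z * (4 * r)"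
      using W z1 by (simp add: ln_mult_pos ln_realpow c_def)
    then have "real (zero_count f r) * c \<le> D + Z * (4 * r)"
      using W z1 by (simp add: D_def ln_div)
    also have "\<dots> \<le> D * r + Z * (4 * r)" using r mult_left_mono[of 1 r D] by (simp add: D_def)
    finally have "real (zero_count f r) * c \<le> (D + 4 * Z) * r" by (simp add: algebra_simps)
    then show ?thesis using c by (simp add: field_simps)
  qed
  moreover have "(D + 4 * Z) / c \<ge> 0" using c W by (simp add: D_def)
  ultimately show ?thesis using that by blast
qed

end

section \<open>Exponent of convergence and subnormality\<close>

lemma polynomial_zero_count_if_convergence_exponent_finite:
  assumes "convergence_exponent f < \<infinity>"
  obtains p r1 where "\<And>r. r \<ge> r1 \<Longrightarrow> real (zero_count f r) \<le> r ^ p"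
proof -
  obtain p :: nat where p: "convergence_exponent f < ereal (real p)"
    using assms less_PInf_Ex_of_nat by auto
  have "\<forall>\<^sub>F r in at_top. ereal (ln (real (zero_count f r)) / ln r) < ereal (real p)"
    using p unfolding convergence_exponent_def by (rule Limsup_lessD)
  then obtain r0 where r0: "\<And>r. r \<ge> r0 \<Longrightarrow> ln (real (zero_count f r)) / ln r < real p"
    by (auto simp: eventually_at_top_linorder)
  have "real (zero_count f r) \<le> r ^ p" if r: "r \<ge> max r0 2" for r
  proof (cases "zero_count f r = 0")
    case False
    have "ln r > 0" using r by simp
    then have "ln (real (zero_count f r)) \<le> real p * ln r" using r0[of r] r by (simp add: field_simps)
    also have "\<dots> = ln (r ^ p)" using r by (simp add: ln_realpow)
    finally show ?thesis using False r by (subst (asm) ln_le_cancel_iff) auto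
  qed (use r in auto)
  then show ?thesis by (rule that)
qed

text \<open>As soon as r \<ge> C, the count is at most r^2, so the quotients are eventually at most
  2.\<close>

lemma convergence_exponent_finite_if_linear_zero_count:
  assumes "C \<ge> 0" and le: "\<And>r. r \<ge> r0 \<Longrightarrow> real (zero_count f r) \<le> C * r"
  shows "convergence_exponent f < \<infinity>"
proof -
  have "\<forall>\<^sub>F r in at_top. ereal (ln (real (zero_count f r)) / ln r) \<le> 2"
    using eventually_ge_at_top[of "max r0 (max 2 C)"]
  proof eventually_elim
    case (elim r)
    have lr: "ln r > 0" using elim by simp
    have "ln (real (zero_count f r)) \<le> 2 * ln r"
    proof (cases "zero_count f r = 0")
      case False
      have "real (zero_count f r) \<le> C * r" using le elim by simp
      also have "\<dots> \<le> r ^ 2" using elim by (simp add: power2_eq_square mult_right_mono)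
      finally have "ln (real (zero_count f r)) \<le> ln (r ^ 2)"
        using False elim by (subst ln_le_cancel_iff) auto
      then show ?thesis using elim by (simp add: ln_realpow)
    qed (use lr in simp)
    then have "ln (real (zero_count f r)) / ln r \<le> 2" using lr by (simp add: field_simps)
    then show ?case by simp
  qed
  then have "convergence_exponent f \<le> 2" unfolding convergence_exponent_def by (rule Limsup_bounded)
  also have "(2::ereal) < \<infinity>" by simp
  finally show ?thesis .
qed

text \<open>The quotients converge to 0. The lower estimate needs ln ln M \<ge> 0, that is, a
  maximum modulus of at least \<open>exp 1\<close> at some radius.\<close>

lemma subnormal_if_log_max_modulus_subexponential:
  assumes hol: "f holomorphic_on UNIV"
    and growth: "\<And>\<epsilon>. \<epsilon> > 0 \<Longrightarrow> \<exists>C. \<forall>r\<ge>0. log_max_modulus f r \<le> C * exp (\<epsilon> * r)"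
  shows "subnormal f"
proof -
  have "((\<lambda>r. ln (ln (max_modulus f r)) / r) \<longlongrightarrow> 0) at_top"
  proof (cases "\<exists>r0\<ge>0. max_modulus f r0 \<ge> exp 1")
    case True
    then obtain r0 where r0: "r0 \<ge> 0" "max_modulus f r0 \<ge> exp 1" by blast
    have ln_ge: "ln (max_modulus f r) \<ge> 1" "ln (max_modulus f r) = log_max_modulus f r" if "r \<ge> r0" for r
    proof -
      have "exp 1 \<le> max_modulus f r" using max_modulus_mono[OF hol r0(1) that] r0(2) by linarith
      moreover from this have "1 \<le> max_modulus f r" using exp_ge_add_one_self[of 1] by linarith
      ultimately show "ln (max_modulus f r) \<ge> 1" "ln (max_modulus f r) = log_max_modulus f r"
        by (simp_all add: ln_ge_iff log_max_modulus_def log_plus_def)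
    qed
    show ?thesis
    proof (rule order_tendstoI)
      fix a :: real assume "a < 0"
      show "\<forall>\<^sub>F r in at_top. a < ln (ln (max_modulus f r)) / r"
        using eventually_ge_at_top[of r0]
      proof eventually_elim
        case (elim r)
        have "0 \<le> ln (ln (max_modulus f r)) / r" using ln_ge(1)[OF elim] r0 elim by simp
        then show ?case using \<open>a < 0\<close> by linarith
      qed
    next
      fix a :: real assume a: "0 < a"
      \<comment> \<open>Using only half of the rate leaves a r / 2 to outgrow ln D.\<close>
      obtain C where C: "\<And>r. r \<ge> 0 \<Longrightarrow> log_max_modulus f r \<le> C * exp (a / 2 * r)"
        using growth[of "a / 2"] a by auto
      define D where "D = max C 1"
      have D: "D \<ge> 1" "D \<ge> C" by (auto simp: D_def)
      show "\<forall>\<^sub>F r in at_top. ln (ln (max_modulus f r)) / r < a"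
        using eventually_gt_at_top[of "max r0 (2 * ln D / a)"]
      proof eventually_elim
        case (elim r)
        have r: "r \<ge> r0" "r > 0" using elim r0 by auto
        have "log_max_modulus f r \<le> C * exp (a / 2 * r)" using C r by simp
        also have "\<dots> \<le> D * exp (a / 2 * r)" using D by (intro mult_right_mono) auto
        finally have "ln (max_modulus f r) \<le> D * exp (a / 2 * r)" using ln_ge(2)[OF r(1)] by simp
        then have "ln (ln (max_modulus f r)) \<le> ln (D * exp (a / 2 * r))"
          using ln_ge(1)[OF r(1)] D by (subst ln_le_cancel_iff) auto
        also have "\<dots> = ln D + a / 2 * r" using D by (simp add: ln_mult_pos)
        also have "\<dots> < a * r" using elim a by (simp add: field_simps)
        finally show ?case using r by (simp add: field_simps)
      qed
    qed
  next
    \<comment> \<open>A function bounded by \<open>exp 1\<close> is constant by Liouville's theorem,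
      and then the quotient is a constant divided by r.\<close>
    case False
    have "cmod (f z) \<le> exp 1" for z
      using False norm_le_max_modulus[OF hol order_refl, of z] by (smt (verit) norm_ge_zero)
    then have "bounded (range f)" by (auto simp: bounded_iff)
    then have "f constant_on UNIV" using Liouville_theorem[OF hol] by blast
    then obtain c where c: "\<And>z. f z = c" by (auto simp: constant_on_def)
    have "max_modulus f r = cmod c" if "r \<ge> 0" for r
      unfolding max_modulus_def using that by (simp add: c)
    then have "\<forall>\<^sub>F r in at_top. ln (ln (cmod c)) / r = ln (ln (max_modulus f r)) / r"
      by (intro eventually_mono[OF eventually_ge_at_top[of 0]]) simp
    moreover have "((\<lambda>r. ln (ln (cmod c)) / r) \<longlongrightarrow> 0) at_top"
      by (intro tendsto_divide_0[OF tendsto_const] filterlim_at_top_imp_at_infinity filterlim_ident)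
    ultimately show ?thesis by (rule Lim_transform_eventually[rotated])
  qed
  then have "((\<lambda>r. ereal (ln (ln (max_modulus f r)) / r)) \<longlongrightarrow> 0) at_top"
    unfolding zero_ereal_def by (rule tendsto_ereal)
  then have "Limsup at_top (\<lambda>r. ereal (ln (ln (max_modulus f r)) / r)) = 0"
    by (intro lim_imp_Limsup) simp_all
  then show ?thesis using hol by (simp add: subnormal_def)
qed

text \<open>Serves both alternatives of \<open>subnormal\<close>, with \<open>g\<close> either ln M
  or T. Where \<open>g r\<close> is not positive, its logarithm carries no information but the bound
  is trivial.\<close>

lemma Limsup_eq_0_quotient_bound:
  fixes g :: "real \<Rightarrow> real"
  assumes "Limsup at_top (\<lambda>r. ereal (ln (g r) / r)) = 0" and a: "a > 0"
  obtains r0 where "r0 \<ge> 1" "\<And>r. r \<ge> r0 \<Longrightarrow> g r \<le> exp (a * r)"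
proof -
  have "Limsup at_top (\<lambda>r. ereal (ln (g r) / r)) < ereal a" using assms by simp
  then have "\<forall>\<^sub>F r in at_top. ereal (ln (g r) / r) < ereal a" by (rule Limsup_lessD)
  then obtain r0 where r0: "\<And>r. r \<ge> r0 \<Longrightarrow> ln (g r) / r < a" by (auto simp: eventually_at_top_linorder)
  have "g r \<le> exp (a * r)" if r: "r \<ge> max r0 1" for r
  proof (cases "g r > 0")
    case True
    have "ln (g r) < a * r" using r0[of r] r by (simp add: field_simps)
    then have "exp (ln (g r)) \<le> exp (a * r)" by simp
    then show ?thesis using True by simp
  next
    case False
    then show ?thesis using exp_gt_zero[of "a * r"] by linarith
  qed
  then show ?thesis by (intro that[of "max r0 1"]) auto
qed

text \<open>This is \<open>log_plus_le_proximity\<close> with R = r + 1, where R - r = 1 and R + r =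
  2 r + 1.\<close>

lemma log_max_modulus_le_nevanlinna_characteristic:
  assumes hol: "f holomorphic_on UNIV" and r: "r \<ge> 0"
  shows "log_max_modulus f r \<le> (2 * r + 1) * nevanlinna_characteristic f (r + 1)"
proof (rule log_max_modulus_le[OF r])
  have le: "log_plus (cmod (f z)) \<le> (2 * r + 1) * nevanlinna_characteristic f (r + 1)" if "cmod z \<le> r" for z
    using log_plus_le_proximity[OF hol that, of "r + 1"] by (simp add: nevanlinna_characteristic_entire[OF hol])
  show "0 \<le> (2 * r + 1) * nevanlinna_characteristic f (r + 1)"
    using order_trans[OF log_plus_nonneg le[of 0]] r by simp
  show "cmod (f z) \<le> exp ((2 * r + 1) * nevanlinna_characteristic f (r + 1))" if "cmod z \<le> r" for z
  proof -
    have "cmod (f z) \<le> exp (log_plus (cmod (f z)))" by (rule le_exp_log_plus)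
    also have "\<dots> \<le> exp ((2 * r + 1) * nevanlinna_characteristic f (r + 1))" using le[OF that] by simp
    finally show ?thesis .
  qed
qed

lemma subnormal_growth:
  assumes "subnormal f"
  obtains X where "X \<ge> 0" "\<And>z. cmod (f z) \<le> exp (X * exp (cmod z / 2))"
proof -
  have hol: "f holomorphic_on UNIV" using assms by (simp add: subnormal_def)
  have "\<exists>r0\<ge>0. \<exists>D\<ge>0. \<forall>r\<ge>r0. log_max_modulus f r \<le> D * exp (r / 2)"
    using assms unfolding subnormal_def
  proof (elim conjE disjE)
    assume "Limsup at_top (\<lambda>r::real. ereal (ln (ln (max_modulus f r)) / r)) = 0"
    from Limsup_eq_0_quotient_bound[OF this, of "1 / 2"]
    obtain r0 where r0: "r0 \<ge> 1" "\<And>r. r \<ge> r0 \<Longrightarrow> ln (max_modulus f r) \<le> exp (r / 2)" by auto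
    have "log_max_modulus f r \<le> 1 * exp (r / 2)" if "r \<ge> r0" for r
      using r0(2)[OF that] by (simp add: log_max_modulus_def log_plus_def max_def)
    then show ?thesis using r0(1) by (intro exI[of _ r0] conjI exI[of _ 1]) auto
  next
    assume "Limsup at_top (\<lambda>r::real. ereal (ln (nevanlinna_characteristic f r) / r)) = 0"
    \<comment> \<open>Half of the rate 1/2 goes to the characteristic; the other half absorbs the
      factor 2 r + 1 \<le> 8 exp (r / 4).\<close>
    from Limsup_eq_0_quotient_bound[OF this, of "1 / 4"]
    obtain r0 where r0: "r0 \<ge> 1" "\<And>r. r \<ge> r0 \<Longrightarrow> nevanlinna_characteristic f r \<le> exp (r / 4)" by auto
    have "log_max_modulus f r \<le> (8 * exp (1 / 4)) * exp (r / 2)" if "r \<ge> r0" for r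
    proof -
      have r: "r \<ge> 0" "r + 1 \<ge> r0" using that r0 by auto
      have "log_max_modulus f r \<le> (2 * r + 1) * nevanlinna_characteristic f (r + 1)"
        by (rule log_max_modulus_le_nevanlinna_characteristic[OF hol r(1)])
      also have "\<dots> \<le> (2 * r + 1) * exp ((r + 1) / 4)" using r0(2)[OF r(2)] r by (intro mult_left_mono) auto
      also have "\<dots> \<le> (8 * exp (r / 4)) * exp ((r + 1) / 4)"
        using exp_ge_add_one_self[of "r / 4"] by (intro mult_right_mono) (linarith | simp)+
      also have "\<dots> = (8 * exp (1 / 4)) * exp (r / 2)"
        by (simp add: mult.assoc exp_add[symmetric] field_simps)
      finally show ?thesis .
    qed
    then show ?thesis using r0(1) by (intro exI[of _ r0] conjI exI[of _ "8 * exp (1 / 4)"]) auto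
  qed
  then obtain r0 D where rD: "r0 \<ge> 0" "D \<ge> 0" "\<And>r. r \<ge> r0 \<Longrightarrow> log_max_modulus f r \<le> D * exp (r / 2)" by blast
  \<comment> \<open>The second summand covers the disc |z| < r0, where the asymptotic bound says
    nothing.\<close>
  define X where "X = D + log_max_modulus f r0"
  have "cmod (f z) \<le> exp (X * exp (cmod z / 2))" for z
  proof -
    have e1: "1 \<le> exp (cmod z / 2)" by simp
    have "log_max_modulus f (cmod z) \<le> X * exp (cmod z / 2)"
    proof (cases "cmod z \<ge> r0")
      case True
      have "D * exp (cmod z / 2) \<le> X * exp (cmod z / 2)" by (intro mult_right_mono) (auto simp: X_def)
      then show ?thesis using rD(3)[OF True] by linarith
    next
      case False
      then have "log_max_modulus f (cmod z) \<le> log_max_modulus f r0" by (intro log_max_modulus_mono hol) auto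
      also have "\<dots> \<le> X * 1" using rD by (simp add: X_def)
      also have "\<dots> \<le> X * exp (cmod z / 2)" using rD by (intro mult_left_mono e1) (simp add: X_def)
      finally show ?thesis .
    qed
    moreover have "cmod (f z) \<le> exp (log_max_modulus f (cmod z))" by (rule norm_le_exp_log_max_modulus[OF hol order_refl])
    ultimately show ?thesis by (smt (verit) exp_le_cancel_iff)
  qed
  then show ?thesis using that[of X] rD(2) by (simp add: X_def)
qed

theorem corollary1p5:
  fixes \<mu> \<nu> \<sigma> :: complex and f :: "complex \<Rightarrow> complex"
  assumes "\<sigma> \<noteq> 0"
    and "f holomorphic_on UNIV"
    and "\<And>z. deriv (deriv f) z + (exp (2 * z) - \<nu>\<^sup>2) * f z = \<sigma> * exp ((\<mu> + 1) * z)"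
  shows "convergence_exponent f < \<infinity> \<longleftrightarrow> subnormal f"
proof -
  interpret exponential_ode \<mu> \<nu> \<sigma> f
    by unfold_locales (use assms in auto)
  show ?thesis
  proof
    assume "convergence_exponent f < \<infinity>"
    then obtain p r1 where "\<And>r. r \<ge> r1 \<Longrightarrow> real (zero_count f r) \<le> r ^ p"
      using polynomial_zero_count_if_convergence_exponent_finite by blast
    then have "\<exists>C. \<forall>r\<ge>0. log_max_modulus f r \<le> C * exp (\<epsilon> * r)" if "\<epsilon> > 0" for \<epsilon>
      using log_max_modulus_subexponential[of r1 p \<epsilon>] that by metis
    then show "subnormal f" by (rule subnormal_if_log_max_modulus_subexponential[OF assms(2)])
  next
    assume "subnormal f"
    then obtain X where "X \<ge> 0" "\<And>z. cmod (f z) \<le> exp (X * exp (cmod z / 2))"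
      using subnormal_growth by blast
    then obtain W Z where "W \<ge> 1" "Z \<ge> 0" "\<And>z. cmod (f z) \<le> W * exp (Z * cmod z)"
      using exponential_type by blast
    then obtain C r0 where "C \<ge> 0" "\<And>r. r \<ge> r0 \<Longrightarrow> real (zero_count f r) \<le> C * r"
      using zero_count_linear by blast
    then show "convergence_exponent f < \<infinity>" by (rule convergence_exponent_finite_if_linear_zero_count)
  qed
qed

end
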